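(* Let $R$ be a ring and let $\mathcal{S}$ be a right noetherian point annihilator set for $R$ that is closed under similarity. The following are equivalent: (1) $R$ is a principal right ideal ring; (2) every right ideal in $\mathcal{S}$ is principal; (3) $\mathcal{F}_{\mathrm{pr}}^{\circ}(R)$ is a right noetherian point annihilator set for $R$. In particular, $R$ is a principal right ideal ring if and only if every cocritical right ideal of $R$ is principal.
   Context: Rings are associative with identity; modules are unital right modules. A principal right ideal ring is a ring in which every right ideal is principal (of the form $xR$). Right ideals $I, J$ of $R$ are similar, $I \sim J$, if $R/I \cong R/J$ as right $R$-modules; a set $\mathcal{S}$ of right ideals is closed under similarity if $I \in \mathcal{S}$ and $J \sim I$ imply $J \in \mathcal{S}$. $\mathcal{F}_{\mathrm{pr}}^{\circ}(R)$ denotes the set of right ideals $I$ of $R$ such that every right ideal $J$ with $J \sim I$ is principal. A point annihilator of a right module $M$ is the annihilator $\mathrm{ann}(m)=\{r\in R: mr=0\}$ of some nonzero $m \in M$. A set $\mathcal{S}$ of right ideals of $R$ is a right noetherian point annihilator set for $R$ if every nonzero noetherian right $R$-module has a point annihilator lying in $\mathcal{S}$ (members of $\mathcal{S}$ are otherwise arbitrary). Krull dimension here is the Gabriel–Rentschler Krull dimension: $\mathcal{K}_{-1}$ is the class consisting of the zero module; for an ordinal $\alpha \ge 0$, $\mathcal{K}_\alpha$ is the class of modules $M$ such that for every descending chain $M_0 \supseteq M_1 \supseteq \cdots$ of submodules of $M$, $M_i/M_{i+1} \in \bigcup_{\beta<\alpha}\mathcal{K}_\beta$ for all but finitely many $i$;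 $\mathrm{K.dim}(M)$ is the least $\alpha$ (where $-1$ counts as an ordinal) with $M \in \mathcal{K}_\alpha$, if it exists. A module $M$ is $\alpha$-critical ($\alpha \geq 0$ an ordinal) if $\mathrm{K.dim}(M) = \alpha$ and $\mathrm{K.dim}(M/N) < \alpha$ for every nonzero submodule $N$ of $M$; it is critical if it is $\alpha$-critical for some $\alpha$. A right ideal $I$ of $R$ is cocritical if the right module $R/I$ is critical. *)

theory Defs
  imports "HOL-Algebra.Module" "HOL-Algebra.AbelCoset" "HOL-Library.Option_ord"
begin

section \<open>Right modules over a noncommutative ring\<close>

text \<open>
  We reuse the record \<^type>\<open>module\<close> of HOL-Algebra, reading \<open>r \<odot>\<^bsub>M\<^esub> x\<close> as the right action
  \<open>x \<cdot> r\<close>; this reading is fixed by the order of the factors in \<open>smult_assoc\<close>.  The locale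
  \<^locale>\<open>module\<close> itself is only available over commutative rings.  The fields \<^const>\<open>mult\<close> and
  \<^const>\<open>one\<close> of the record are never used for modules.
\<close>

locale right_module = R?: ring R + M?: abelian_group M
  for R :: "('a, 'r) ring_scheme" (structure) and M :: "('a, 'm) module" (structure) +
  assumes smult_closed [simp, intro]:
      "\<lbrakk>r \<in> carrier R; x \<in> carrier M\<rbrakk> \<Longrightarrow> r \<odot>\<^bsub>M\<^esub> x \<in> carrier M"
    and smult_l_distr:
      "\<lbrakk>r \<in> carrier R; s \<in> carrier R; x \<in> carrier M\<rbrakk> \<Longrightarrow>
        (r \<oplus> s) \<odot>\<^bsub>M\<^esub> x = r \<odot>\<^bsub>M\<^esub> x \<oplus>\<^bsub>M\<^esub> s \<odot>\<^bsub>M\<^esub> x"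
    and smult_r_distr:
      "\<lbrakk>r \<in> carrier R; x \<in> carrier M; y \<in> carrier M\<rbrakk> \<Longrightarrow>
        r \<odot>\<^bsub>M\<^esub> (x \<oplus>\<^bsub>M\<^esub> y) = r \<odot>\<^bsub>M\<^esub> x \<oplus>\<^bsub>M\<^esub> r \<odot>\<^bsub>M\<^esub> y"
    and smult_assoc:
      "\<lbrakk>r \<in> carrier R; s \<in> carrier R; x \<in> carrier M\<rbrakk> \<Longrightarrow>
        (r \<otimes> s) \<odot>\<^bsub>M\<^esub> x = s \<odot>\<^bsub>M\<^esub> (r \<odot>\<^bsub>M\<^esub> x)"
    and smult_one [simp]: "x \<in> carrier M \<Longrightarrow> \<one> \<odot>\<^bsub>M\<^esub> x = x"

definition zero_module :: "('a, 'm) module \<Rightarrow> bool" where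
  "zero_module M \<longleftrightarrow> carrier M = {\<zero>\<^bsub>M\<^esub>}"

definition rmod_iso :: "('a, 'r) ring_scheme \<Rightarrow> ('a, 'm) module \<Rightarrow> ('a, 'n) module \<Rightarrow> bool" where
  "rmod_iso R M N \<longleftrightarrow> (\<exists>f. bij_betw f (carrier M) (carrier N)
     \<and> (\<forall>x \<in> carrier M. \<forall>y \<in> carrier M. f (x \<oplus>\<^bsub>M\<^esub> y) = f x \<oplus>\<^bsub>N\<^esub> f y)
     \<and> (\<forall>r \<in> carrier R. \<forall>x \<in> carrier M. f (r \<odot>\<^bsub>M\<^esub> x) = r \<odot>\<^bsub>N\<^esub> f x))"

definition quot_module :: "('a, 'm) module \<Rightarrow> 'm set \<Rightarrow> ('a, 'm set) module" where
  "quot_module M N = \<lparr>carrier = a_rcosets\<^bsub>M\<^esub> N, mult = undefined, one = undefined,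
     zero = N, add = set_add M,
     smult = (\<lambda>r X. N <+>\<^bsub>M\<^esub> (\<lambda>x. r \<odot>\<^bsub>M\<^esub> x) ` X)\<rparr>"

definition regular_module :: "('a, 'r) ring_scheme \<Rightarrow> ('a, 'a) module" where
  "regular_module R = \<lparr>carrier = carrier R, mult = undefined, one = undefined,
     zero = \<zero>\<^bsub>R\<^esub>, add = add R, smult = (\<lambda>r x. x \<otimes>\<^bsub>R\<^esub> r)\<rparr>"

definition noetherian_module :: "('a, 'r) ring_scheme \<Rightarrow> ('a, 'm) module \<Rightarrow> bool" where
  "noetherian_module R M \<longleftrightarrow>
     (\<forall>C :: nat \<Rightarrow> 'm set. (\<forall>i. submodule (C i) R M) \<and> (\<forall>i. C i \<subseteq> C (Suc i))
        \<longrightarrow> (\<exists>n. \<forall>i\<ge>n. C i = C n))"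

definition annihilator :: "('a, 'r) ring_scheme \<Rightarrow> ('a, 'm) module \<Rightarrow> 'm \<Rightarrow> 'a set" where
  "annihilator R M x = {r \<in> carrier R. r \<odot>\<^bsub>M\<^esub> x = \<zero>\<^bsub>M\<^esub>}"

definition point_annihilator :: "('a, 'r) ring_scheme \<Rightarrow> ('a, 'm) module \<Rightarrow> 'a set \<Rightarrow> bool" where
  "point_annihilator R M I \<longleftrightarrow> (\<exists>x \<in> carrier M. x \<noteq> \<zero>\<^bsub>M\<^esub> \<and> I = annihilator R M x)"

text \<open>
  \<^const>\<open>add_monoid\<close>-records of different modules differ in the type of their extension field.
\<close>

lemma comm_group_cong:
  assumes "comm_group G" "carrier H = carrier G" "mult H = mult G" "one H = one G"
  shows "comm_group H"
proof -
  interpret G: comm_group G by fact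
  show ?thesis
    by (rule comm_groupI) (auto simp: assms G.m_ac intro: G.l_inv_ex)
qed

lemma m_inv_cong:
  "carrier H = carrier G \<Longrightarrow> mult H = mult G \<Longrightarrow> one H = one G \<Longrightarrow> inv\<^bsub>H\<^esub> x = inv\<^bsub>G\<^esub> x"
  by (simp add: m_inv_def)

context right_module begin

lemma submodule_abelian_subgroup: "submodule N R M \<Longrightarrow> abelian_subgroup N M"
  by (intro abelian_subgroupI3 M.abelian_group_axioms additive_subgroup.intro)
     (auto simp: submodule_def)

lemma quot_smult_coset:
  assumes "submodule N R M" "r \<in> carrier R" "x \<in> carrier M"
  shows "r \<odot>\<^bsub>quot_module M N\<^esub> (N +>\<^bsub>M\<^esub> x) = N +>\<^bsub>M\<^esub> (r \<odot>\<^bsub>M\<^esub> x)"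
proof -
  interpret N: abelian_subgroup N M using submodule_abelian_subgroup[OF assms(1)] .
  have N: "r \<odot>\<^bsub>M\<^esub> n \<in> N" if "n \<in> N" for n
    using assms that by (simp add: submodule.smult_closed)
  have "N <+>\<^bsub>M\<^esub> (\<lambda>x. r \<odot>\<^bsub>M\<^esub> x) ` (N +>\<^bsub>M\<^esub> x) = N +>\<^bsub>M\<^esub> (r \<odot>\<^bsub>M\<^esub> x)" (is "?L = ?R")
  proof
    show "?L \<subseteq> ?R"
    proof
      fix z assume "z \<in> ?L"
      then obtain n n' where n: "n \<in> N" "n' \<in> N"
        and z: "z = n \<oplus>\<^bsub>M\<^esub> (r \<odot>\<^bsub>M\<^esub> (n' \<oplus>\<^bsub>M\<^esub> x))"
        by (auto simp: set_add_def' a_r_coset_def')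
      have "z = (n \<oplus>\<^bsub>M\<^esub> (r \<odot>\<^bsub>M\<^esub> n')) \<oplus>\<^bsub>M\<^esub> (r \<odot>\<^bsub>M\<^esub> x)"
        using n assms N by (simp add: z smult_r_distr M.a_assoc)
      then show "z \<in> ?R"
        using n N by (auto simp: a_r_coset_def')
    qed
    show "?R \<subseteq> ?L"
    proof
      fix z assume "z \<in> ?R"
      then obtain n where n: "n \<in> N" "z = n \<oplus>\<^bsub>M\<^esub> (r \<odot>\<^bsub>M\<^esub> x)"
        by (auto simp: a_r_coset_def')
      moreover have "x \<in> N +>\<^bsub>M\<^esub> x" using assms(3) by (rule N.a_rcos_self)
      ultimately show "z \<in> ?L" by (auto simp: set_add_def')
    qed
  qed
  then show ?thesis by (simp add: quot_module_def)
qed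

lemma quot_module_simps [simp]:
  "carrier (quot_module M N) = a_rcosets\<^bsub>M\<^esub> N" "zero (quot_module M N) = N"
  "add (quot_module M N) = set_add M"
  by (simp_all add: quot_module_def)

lemma quot_right_module:
  assumes "submodule N R M"
  shows "right_module R (quot_module M N)"
proof -
  interpret N: abelian_subgroup N M using submodule_abelian_subgroup[OF assms] .
  have cos: "\<exists>x \<in> carrier M. X = N +>\<^bsub>M\<^esub> x" if "X \<in> a_rcosets\<^bsub>M\<^esub> N" for X
    using that by (auto simp: A_RCOSETS_def')
  have cosI: "N +>\<^bsub>M\<^esub> x \<in> a_rcosets\<^bsub>M\<^esub> N" if "x \<in> carrier M" for x
    using that by (auto simp: A_RCOSETS_def')
  have "comm_group (M A_Mod N)" by (rule N.a_factorgroup_is_comm_group)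
  then have "comm_group (add_monoid (quot_module M N))"
    by (rule comm_group_cong)
       (simp_all add: A_FactGroup_def FactGroup_def quot_module_def A_RCOSETS_def set_add_def)
  then have ab: "abelian_group (quot_module M N)"
    by (intro abelian_group.intro abelian_monoid.intro abelian_group_axioms.intro)
       (auto simp: comm_group_def)
  show ?thesis
    apply (intro right_module.intro R.ring_axioms ab right_module_axioms.intro)
        apply (auto dest!: cos simp: quot_smult_coset[OF assms] N.a_rcos_sum cosI
            smult_l_distr smult_r_distr smult_assoc)
    done
qed

end

lemma (in ring) regular_right_module: "right_module R (regular_module R)"
proof -
  have "comm_group (add_monoid (regular_module R))"
    by (rule comm_group_cong[OF a_comm_group]) (simp_all add: regular_module_def)
  then have ab: "abelian_group (regular_module R)"
    by (intro abelian_group.intro abelian_monoid.intro abelian_group_axioms.intro)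
       (auto simp: comm_group_def)
  show ?thesis
    by (intro right_module.intro ring_axioms ab right_module_axioms.intro)
       (auto simp: regular_module_def l_distr r_distr m_assoc)
qed


section \<open>Right ideals\<close>

definition right_ideal :: "'a set \<Rightarrow> ('a, 'r) ring_scheme \<Rightarrow> bool" where
  "right_ideal I R \<longleftrightarrow> additive_subgroup I R \<and> (\<forall>x \<in> I. \<forall>r \<in> carrier R. x \<otimes>\<^bsub>R\<^esub> r \<in> I)"

lemma (in ring) submodule_regular_iff:
  "submodule I R (regular_module R) \<longleftrightarrow> right_ideal I R"
proof -
  have "inv\<^bsub>add_monoid (regular_module R)\<^esub> x = inv\<^bsub>add_monoid R\<^esub> x" for x
    by (rule m_inv_cong) (simp_all add: regular_module_def)
  then show ?thesis
    unfolding submodule_def submodule_axioms_def right_ideal_def additive_subgroup_def subgroup_def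
    by (auto simp: regular_module_def)
qed

definition principal_right_ideal :: "'a set \<Rightarrow> ('a, 'r) ring_scheme \<Rightarrow> bool" where
  "principal_right_ideal I R \<longleftrightarrow> (\<exists>x \<in> carrier R. I = x <#\<^bsub>R\<^esub> carrier R)"

definition principal_right_ideal_ring :: "('a, 'r) ring_scheme \<Rightarrow> bool" where
  "principal_right_ideal_ring R \<longleftrightarrow>
     ring R \<and> (\<forall>I. right_ideal I R \<longrightarrow> principal_right_ideal I R)"

definition similar :: "('a, 'r) ring_scheme \<Rightarrow> 'a set \<Rightarrow> 'a set \<Rightarrow> bool" where
  "similar R I J \<longleftrightarrow>
     rmod_iso R (quot_module (regular_module R) I) (quot_module (regular_module R) J)"

definition closed_under_similarity :: "('a, 'r) ring_scheme \<Rightarrow> 'a set set \<Rightarrow> bool" where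
  "closed_under_similarity R S \<longleftrightarrow>
     (\<forall>I J. I \<in> S \<and> right_ideal J R \<and> similar R J I \<longrightarrow> J \<in> S)"

definition F_pr_circ :: "('a, 'r) ring_scheme \<Rightarrow> 'a set set" where
  "F_pr_circ R = {I. right_ideal I R \<and>
     (\<forall>J. right_ideal J R \<and> similar R J I \<longrightarrow> principal_right_ideal J R)}"

text \<open>
  A definition cannot quantify over modules on all types.  Modules whose carrier is a set of subsets
  of the ring suffice, because this type contains every cyclic module \<open>R/I\<close>; the lemma
  \<open>right_noetherian_pa_set_any_type\<close> below shows that the defining property then holds for
  noetherian modules over \<open>R\<close> on an arbitrary type.
\<close>

definition right_noetherian_pa_set :: "('a, 'r) ring_scheme \<Rightarrow> 'a set set \<Rightarrow> bool" where
  "right_noetherian_pa_set R S \<longleftrightarrow>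
     (\<forall>I \<in> S. right_ideal I R) \<and>
     (\<forall>M :: ('a, 'a set) module.
        right_module R M \<and> noetherian_module R M \<and> \<not> zero_module M
          \<longrightarrow> (\<exists>I \<in> S. point_annihilator R M I))"

lemma right_noetherian_pa_set_any_type:
  fixes M :: "('a, 'm) module"
  assumes pa: "right_noetherian_pa_set R S" and M: "right_module R M"
    and noeth: "noetherian_module R M" and nz: "\<not> zero_module M"
  shows "\<exists>I \<in> S. point_annihilator R M I"
proof -
  interpret right_module R M by fact
  interpret Rg: right_module R "regular_module R" by (rule R.regular_right_module)
  have rg: "carrier (regular_module R) = carrier R" "add (regular_module R) = add R"
    "zero (regular_module R) = zero R" "\<And>r x. r \<odot>\<^bsub>regular_module R\<^esub> x = x \<otimes>\<^bsub>R\<^esub> r"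
    by (simp_all add: regular_module_def)
  have rgc: "a_r_coset (regular_module R) = a_r_coset R" "A_RCOSETS (regular_module R) = A_RCOSETS R"
    "set_add (regular_module R) = set_add R"
    by (intro ext, simp add: a_r_coset_def' A_RCOSETS_def' set_add_def' rg)+
  obtain m where m: "m \<in> carrier M" "m \<noteq> \<zero>\<^bsub>M\<^esub>"
    using nz M.zero_closed by (auto simp: zero_module_def)
  define f where "f r = r \<odot>\<^bsub>M\<^esub> m" for r
  have f [simp, intro]: "r \<in> carrier R \<Longrightarrow> f r \<in> carrier M" for r using m by (simp add: f_def)
  have f_add: "f (r \<oplus>\<^bsub>R\<^esub> s) = f r \<oplus>\<^bsub>M\<^esub> f s" if "r \<in> carrier R" "s \<in> carrier R" for r s
    using that m by (simp add: f_def smult_l_distr)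
  have f_mult: "f (r \<otimes>\<^bsub>R\<^esub> s) = s \<odot>\<^bsub>M\<^esub> f r" if "r \<in> carrier R" "s \<in> carrier R" for r s
    using that m by (simp add: f_def smult_assoc)
  have f_0: "f \<zero>\<^bsub>R\<^esub> = \<zero>\<^bsub>M\<^esub>"
    using f_add[of "\<zero>\<^bsub>R\<^esub>" "\<zero>\<^bsub>R\<^esub>"] M.add.l_cancel_one' by auto
  have f_minus: "f (\<ominus>\<^bsub>R\<^esub> r) = \<ominus>\<^bsub>M\<^esub> f r" if "r \<in> carrier R" for r
    using f_add[of "\<ominus>\<^bsub>R\<^esub> r" r] that f_0 by (simp add: R.l_neg M.minus_equality)
  define I where "I = annihilator R M m"
  have Iiff: "r \<in> I \<longleftrightarrow> r \<in> carrier R \<and> f r = \<zero>\<^bsub>M\<^esub>" for r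
    by (auto simp: I_def annihilator_def f_def)
  have smult_0: "r \<odot>\<^bsub>M\<^esub> \<zero>\<^bsub>M\<^esub> = \<zero>\<^bsub>M\<^esub>" if "r \<in> carrier R" for r
    using that smult_r_distr[of r "\<zero>\<^bsub>M\<^esub>" "\<zero>\<^bsub>M\<^esub>"] M.add.l_cancel_one' by auto
  have "additive_subgroup I R"
    by (intro additive_subgroup.intro subgroup.intro)
       (auto simp: Iiff f_add f_0 f_minus a_inv_def[symmetric])
  note addI = this
  then have rI: "right_ideal I R"
    by (auto simp: right_ideal_def Iiff f_mult smult_0)
  then have sI: "submodule I R (regular_module R)" by (simp add: R.submodule_regular_iff)
  interpret I: abelian_subgroup I R
    by (intro abelian_subgroupI3 addI R.abelian_group_axioms)
  define Q where "Q = quot_module (regular_module R) I"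
  have Q: "right_module R Q" unfolding Q_def by (rule Rg.quot_right_module[OF sI])
  interpret Q: right_module R Q by fact
  have Qs: "carrier Q = a_rcosets\<^bsub>R\<^esub> I" "zero Q = I" "add Q = set_add R"
    by (simp_all add: Q_def rgc quot_module_def)
  have Qsm: "s \<odot>\<^bsub>Q\<^esub> (I +>\<^bsub>R\<^esub> r) = I +>\<^bsub>R\<^esub> (r \<otimes>\<^bsub>R\<^esub> s)" if "r \<in> carrier R" "s \<in> carrier R" for r s
    using Rg.quot_smult_coset[OF sI, of s r] that by (simp add: Q_def rg rgc)
  have Qin: "I +>\<^bsub>R\<^esub> r \<in> carrier Q" if "r \<in> carrier R" for r
    using that by (auto simp: Qs A_RCOSETS_def')
  have Qadd: "(I +>\<^bsub>R\<^esub> r) \<oplus>\<^bsub>Q\<^esub> (I +>\<^bsub>R\<^esub> s) = I +>\<^bsub>R\<^esub> (r \<oplus>\<^bsub>R\<^esub> s)"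
    if "r \<in> carrier R" "s \<in> carrier R" for r s
    using that by (simp add: Qs I.a_rcos_sum)
  have cos: "\<exists>r \<in> carrier R. X = I +>\<^bsub>R\<^esub> r" if "X \<in> carrier Q" for X
    using that by (auto simp: Qs A_RCOSETS_def')
  have eq_I: "I +>\<^bsub>R\<^esub> r = I \<longleftrightarrow> f r = \<zero>\<^bsub>M\<^esub>" if "r \<in> carrier R" for r
    using that I.a_rcos_self I.a_rcos_const by (metis Iiff)
  have eq_cos: "I +>\<^bsub>R\<^esub> r = I +>\<^bsub>R\<^esub> s" if "r \<in> carrier R" "s \<in> carrier R" "f r = f s" for r s
  proof -
    have "r \<ominus>\<^bsub>R\<^esub> s \<in> I"
      using that by (simp add: Iiff R.minus_eq f_add f_minus M.r_neg)
    then have "I +>\<^bsub>R\<^esub> ((r \<ominus>\<^bsub>R\<^esub> s) \<oplus>\<^bsub>R\<^esub> s) = I +>\<^bsub>R\<^esub> s"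
      using that R.a_coset_add_assoc I.a_rcos_const I.a_subset by (metis R.minus_closed)
    moreover have "(r \<ominus>\<^bsub>R\<^esub> s) \<oplus>\<^bsub>R\<^esub> s = r"
      using that by (simp add: R.minus_eq R.a_assoc R.l_neg)
    ultimately show ?thesis by simp
  qed
  have "noetherian_module R Q"
    unfolding noetherian_module_def
  proof (intro allI impI, elim conjE)
    fix C :: "nat \<Rightarrow> 'a set set"
    assume C: "\<forall>i. submodule (C i) R Q" and mono: "\<forall>i. C i \<subseteq> C (Suc i)"
    define D where "D i = f ` {r \<in> carrier R. I +>\<^bsub>R\<^esub> r \<in> C i}" for i
    have "submodule (D i) R M" for i
    proof -
      interpret C: submodule "C i" R Q using C by blast
      have C0: "I \<in> C i" using C.one_closed by (simp add: Qs)
      have Cp: "I +>\<^bsub>R\<^esub> (r \<oplus>\<^bsub>R\<^esub> s) \<in> C i"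
        if "I +>\<^bsub>R\<^esub> r \<in> C i" "I +>\<^bsub>R\<^esub> s \<in> C i" "r \<in> carrier R" "s \<in> carrier R" for r s
        using C.m_closed[of "I +>\<^bsub>R\<^esub> r" "I +>\<^bsub>R\<^esub> s"] that by (simp add: Qadd)
      have Cm: "I +>\<^bsub>R\<^esub> (r \<otimes>\<^bsub>R\<^esub> s) \<in> C i"
        if "I +>\<^bsub>R\<^esub> r \<in> C i" "r \<in> carrier R" "s \<in> carrier R" for r s
        using C.smult_closed[of s "I +>\<^bsub>R\<^esub> r"] that by (simp add: Qsm)
      have Cn: "I +>\<^bsub>R\<^esub> (\<ominus>\<^bsub>R\<^esub> r) \<in> C i"
        if "I +>\<^bsub>R\<^esub> r \<in> C i" "r \<in> carrier R" for r
        using Cm[of r "\<ominus>\<^bsub>R\<^esub> \<one>\<^bsub>R\<^esub>"] that by (simp add: R.r_minus)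
      show ?thesis
      proof (intro submodule.intro subgroup.intro submodule_axioms.intro)
        show "D i \<subseteq> carrier (add_monoid M)" by (auto simp: D_def)
        show "\<one>\<^bsub>add_monoid M\<^esub> \<in> D i"
          by (auto simp: D_def f_0[symmetric] C0 I.a_rcos_const I.zero_closed intro!: imageI)
      next
        fix x y assume "x \<in> D i" "y \<in> D i"
        then show "x \<otimes>\<^bsub>add_monoid M\<^esub> y \<in> D i"
          by (auto simp: D_def f_add[symmetric] Cp intro!: imageI)
      next
        fix x assume "x \<in> D i"
        then show "inv\<^bsub>add_monoid M\<^esub> x \<in> D i"
          by (auto simp: D_def f_minus[symmetric] a_inv_def[symmetric] Cn intro!: imageI)
      next
        fix a x assume "a \<in> carrier R" "x \<in> D i"
        then show "a \<odot>\<^bsub>M\<^esub> x \<in> D i"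
          by (auto simp: D_def f_mult[symmetric] Cm intro!: imageI)
      qed
    qed
    moreover have "D i \<subseteq> D (Suc i)" for i using mono by (auto simp: D_def)
    ultimately obtain n where n: "\<And>i. i \<ge> n \<Longrightarrow> D i = D n"
      using noeth unfolding noetherian_module_def by blast
    have sub: "C i \<subseteq> C j" if "D i \<subseteq> D j" for i j
    proof
      fix X assume X: "X \<in> C i"
      then have "X \<in> carrier Q"
        using C subgroup.subset[of "C i" "add_monoid Q"] by (auto simp: submodule_def)
      then obtain r where r: "r \<in> carrier R" "X = I +>\<^bsub>R\<^esub> r" using cos by blast
      with X that have "f r \<in> D j" by (auto simp: D_def)
      then obtain s where "s \<in> carrier R" "I +>\<^bsub>R\<^esub> s \<in> C j" "f r = f s" by (auto simp: D_def)
      then show "X \<in> C j" using r eq_cos by metis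
    qed
    show "\<exists>n. \<forall>i\<ge>n. C i = C n" using n sub by (intro exI[of _ n]) blast
  qed
  moreover have "\<not> zero_module Q"
  proof
    assume "zero_module Q"
    then have "I +>\<^bsub>R\<^esub> \<one>\<^bsub>R\<^esub> = I" using Qin[of "\<one>\<^bsub>R\<^esub>"] by (simp add: zero_module_def Qs(2))
    then show False using eq_I[of "\<one>\<^bsub>R\<^esub>"] m by (simp add: f_def)
  qed
  ultimately obtain J where J: "J \<in> S" "point_annihilator R Q J"
    using pa Q unfolding right_noetherian_pa_set_def by blast
  then obtain X where X: "X \<in> carrier Q" "X \<noteq> I" "J = annihilator R Q X"
    by (auto simp: point_annihilator_def Qs(2))
  then obtain r where r: "r \<in> carrier R" "X = I +>\<^bsub>R\<^esub> r" using cos by blast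
  have "s \<odot>\<^bsub>Q\<^esub> X = \<zero>\<^bsub>Q\<^esub> \<longleftrightarrow> s \<odot>\<^bsub>M\<^esub> f r = \<zero>\<^bsub>M\<^esub>" if "s \<in> carrier R" for s
    using that r eq_I[of "r \<otimes>\<^bsub>R\<^esub> s"] by (simp add: Qsm Qs(2) f_mult)
  then have "J = annihilator R M (f r)"
    unfolding X(3) annihilator_def by blast
  moreover have "f r \<noteq> \<zero>\<^bsub>M\<^esub>" using X r eq_I by blast
  ultimately show ?thesis using J r by (auto simp: point_annihilator_def)
qed


section \<open>Ordinals\<close>

text \<open>
  The ordinals of cardinality at most that of \<open>'x\<close>: isomorphism classes of well-orders whose field
  is a subset of \<open>'x\<close>.
\<close>

quotient_type 'x ordinal = "'x rel" / partial: "\<lambda>r s. (r, s) \<in> ordIso"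
proof (rule part_equivpI)
  show "\<exists>r :: 'x rel. (r, r) \<in> ordIso"
    by (rule exI[of _ "{}"], rule ordIso_reflexive) simp
qed (auto intro!: sympI transpI intro: ordIso_symmetric ordIso_transitive)

lemma ordIso_Well_order:
  "(r, s) \<in> ordIso \<Longrightarrow> Well_order r" "(r, s) \<in> ordIso \<Longrightarrow> Well_order s"
  by (auto simp: ordIso_def)

instantiation ordinal :: (type) wellorder
begin

lift_definition less_eq_ordinal :: "'a ordinal \<Rightarrow> 'a ordinal \<Rightarrow> bool" is "\<lambda>r s. (r, s) \<in> ordLeq"
  by (meson ordIso_ordLeq_trans ordIso_symmetric ordLeq_ordIso_trans)

lift_definition less_ordinal :: "'a ordinal \<Rightarrow> 'a ordinal \<Rightarrow> bool" is "\<lambda>r s. (r, s) \<in> ordLess"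
  by (meson ordIso_ordLess_trans ordIso_symmetric ordLess_ordIso_trans)

instance
proof
  fix x y z :: "'a ordinal"
  show "x < y \<longleftrightarrow> x \<le> y \<and> \<not> y \<le> x"
    by transfer (meson not_ordLess_ordLeq ordIso_Well_order ordLess_imp_ordLeq
        ordLess_or_ordLeq)
  show "x \<le> x"
    by transfer (simp add: ordIso_imp_ordLeq)
  show "x \<le> y \<Longrightarrow> y \<le> z \<Longrightarrow> x \<le> z"
    by transfer (rule ordLeq_transitive)
  show "x \<le> y \<Longrightarrow> y \<le> x \<Longrightarrow> x = y"
    by transfer (simp add: ordIso_iff_ordLeq)
  show "x \<le> y \<or> y \<le> x"
    by transfer (meson ordIso_Well_order ordLeq_total)
next
  fix P :: "'a ordinal \<Rightarrow> bool" and a :: "'a ordinal"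
  assume step: "\<And>x. (\<And>y. y < x \<Longrightarrow> P y) \<Longrightarrow> P x"
  have "wf {(x, y :: 'a ordinal). x < y}"
    by (rule wf_subset[OF wf_inv_image[OF wf_ordLess, of rep_ordinal]])
       (auto simp: inv_image_def less_ordinal.rep_eq)
  then show "P a"
    by (induction a rule: wf_induct_rule) (auto intro: step)
qed

end


section \<open>Krull dimension\<close>

text \<open>
  The index \<open>None\<close> stands for \<open>-1\<close>, and \<open>Some \<alpha>\<close> for the ordinal \<open>\<alpha>\<close>; \<open>None\<close> is the least element
  of the order on options.  The index type is an arbitrary well-ordered type.  The factor
  \<open>M\<^sub>i/M\<^sub>i\<^sub>+\<^sub>1\<close> lives on the type \<open>'m set\<close>; it is replaced by an isomorphic module \<open>N\<close> on \<open>'m\<close> (which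
  always exists, by choice of coset representatives) to keep the recursion within one type.
\<close>

inductive krull_class ::
  "('a, 'r) ring_scheme \<Rightarrow> 'o :: wellorder option \<Rightarrow> ('a, 'm) module \<Rightarrow> bool" for R
where
  minus_one: "right_module R M \<Longrightarrow> zero_module M \<Longrightarrow> krull_class R None M"
| ordinal: "right_module R M \<Longrightarrow>
    (\<forall>C :: nat \<Rightarrow> 'm set. (\<forall>i. submodule (C i) R M) \<and> (\<forall>i. C (Suc i) \<subseteq> C i) \<longrightarrow>
       (\<exists>n. \<forall>i\<ge>n. \<exists>\<beta> < Some \<alpha>. \<exists>N :: ('a, 'm) module.
          rmod_iso R (quot_module (M\<lparr>carrier := C i\<rparr>) (C (Suc i))) N \<and> krull_class R \<beta> N))
    \<Longrightarrow> krull_class R (Some \<alpha>) M"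

definition has_krull_dim ::
  "('a, 'r) ring_scheme \<Rightarrow> ('a, 'm) module \<Rightarrow> 'o :: wellorder option \<Rightarrow> bool" where
  "has_krull_dim R M \<alpha> \<longleftrightarrow> krull_class R \<alpha> M \<and> (\<forall>\<beta><\<alpha>. \<not> krull_class R \<beta> M)"

definition critical_of_dim ::
  "('a, 'r) ring_scheme \<Rightarrow> 'o :: wellorder \<Rightarrow> ('a, 'm) module \<Rightarrow> bool" where
  "critical_of_dim R \<alpha> M \<longleftrightarrow> right_module R M \<and> has_krull_dim R M (Some \<alpha>) \<and>
     (\<forall>N. submodule N R M \<and> N \<noteq> {\<zero>\<^bsub>M\<^esub>}
        \<longrightarrow> (\<exists>\<beta> < Some \<alpha>. has_krull_dim R (quot_module M N) \<beta>))"

lemma krull_class_Some_iff: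
  "krull_class R (Some \<alpha>) (M :: ('a, 'm) module) \<longleftrightarrow> right_module R M \<and>
    (\<forall>C :: nat \<Rightarrow> 'm set. (\<forall>i. submodule (C i) R M) \<and> (\<forall>i. C (Suc i) \<subseteq> C i) \<longrightarrow>
       (\<exists>n. \<forall>i\<ge>n. \<exists>\<beta> < Some \<alpha>. \<exists>N :: ('a, 'm) module.
          rmod_iso R (quot_module (M\<lparr>carrier := C i\<rparr>) (C (Suc i))) N \<and> krull_class R \<beta> N))"
  by (subst krull_class.simps) simp

lemma krull_class_any_wellorder:
  fixes M :: "('a, 'm) module" and \<alpha> :: "'o :: wellorder option"
  assumes "krull_class R \<alpha> M"
  shows "\<exists>\<beta> :: ('a, 'm) module ordinal option. krull_class R \<beta> M"
proof -
  define W where "W = {a :: 'o. \<exists>N :: ('a, 'm) module. has_krull_dim R N (Some a)}"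
  define g where "g a = (SOME N :: ('a, 'm) module. has_krull_dim R N (Some a))" for a :: 'o
  have g: "has_krull_dim R (g a) (Some a)" if "a \<in> W" for a
    using that unfolding W_def g_def mem_Collect_eq by (rule someI_ex)
  have uniq: "a = b" if "has_krull_dim R N a" "has_krull_dim R N b"
    for a b :: "'o option" and N :: "('a, 'm) module"
    using that unfolding has_krull_dim_def by (metis linorder_neqE)
  have inj: "inj_on g W"
    by (rule inj_onI) (metis g uniq option.inject)
  define r where "r A = {(g x, g y) | x y. x \<in> A \<and> y \<in> A \<and> x \<le> y}" for A
  have Field_r: "Field (r A) = g ` A" for A
    by (auto simp: r_def Field_def)
  have mem_r: "(g x, g y) \<in> r A \<longleftrightarrow> x \<in> A \<and> y \<in> A \<and> x \<le> y"
    if "A \<subseteq> W" "x \<in> W" "y \<in> W" for A x y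
  proof
    assume "(g x, g y) \<in> r A"
    then obtain x' y' where *: "g x = g x'" "g y = g y'" "x' \<in> A" "y' \<in> A" "x' \<le> y'"
      by (auto simp: r_def)
    then have "x = x'" "y = y'"
      using that inj_onD[OF inj] by blast+
    with * show "x \<in> A \<and> y \<in> A \<and> x \<le> y" by simp
  qed (auto simp: r_def)
  have wo: "Well_order (r A)" if A: "A \<subseteq> W" for A
  proof -
    have "wf (r A - Id)"
    proof (rule wfI_min)
      fix x :: "('a, 'm) module" and Q assume "x \<in> Q"
      show "\<exists>z\<in>Q. \<forall>y. (y, z) \<in> r A - Id \<longrightarrow> y \<notin> Q"
      proof (cases "\<exists>a \<in> A. g a \<in> Q")
        case True
        define a where "a = (LEAST a. a \<in> A \<and> g a \<in> Q)"
        have a: "a \<in> A" "g a \<in> Q" using True LeastI_ex[of "\<lambda>a. a \<in> A \<and> g a \<in> Q"]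
          by (auto simp: a_def)
        have least: "a \<le> b" if "b \<in> A" "g b \<in> Q" for b
          unfolding a_def using that by (intro Least_le) auto
        have "y \<notin> Q" if y: "(y, g a) \<in> r A - Id" for y
        proof
          assume "y \<in> Q"
          from y obtain b where b: "y = g b" "b \<in> A" by (auto simp: r_def)
          then have "b \<le> a" using y mem_r[of A b a] A a by auto
          moreover have "a \<le> b" using least b \<open>y \<in> Q\<close> by blast
          ultimately show False using y b by simp
        qed
        then show ?thesis using a by blast
      next
        case False
        then show ?thesis using \<open>x \<in> Q\<close> by (intro bexI[of _ x]) (auto simp: r_def)
      qed
    qed
    moreover have "refl_on (g ` A) (r A)" by (auto simp: refl_on_def r_def)
    moreover have "trans (r A)"
    proof (rule transI)
      fix x y z assume xy: "(x, y) \<in> r A" and yz: "(y, z) \<in> r A"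
      then obtain a b c where *: "x = g a" "y = g b" "z = g c" "a \<in> A" "b \<in> A" "c \<in> A"
        by (auto simp: r_def)
      then have "a \<in> W" "b \<in> W" "c \<in> W" using A by auto
      with xy yz * show "(x, z) \<in> r A" by (auto simp: mem_r[OF A])
    qed
    moreover have "antisym (r A)"
    proof (rule antisymI)
      fix x y assume xy: "(x, y) \<in> r A" and yz: "(y, x) \<in> r A"
      then obtain a b where *: "x = g a" "y = g b" "a \<in> A" "b \<in> A"
        by (auto simp: r_def)
      then have "a \<in> W" "b \<in> W" using A by auto
      with xy yz * have "a = b" by (auto simp: mem_r[OF A])
      with * show "x = y" by simp
    qed
    moreover have "total_on (g ` A) (r A)"
    proof (rule total_onI)
      fix x y assume "x \<in> g ` A" "y \<in> g ` A"
      then obtain a b where *: "x = g a" "y = g b" "a \<in> A" "b \<in> A" by auto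
      then have "a \<in> W" "b \<in> W" using A by auto
      with * show "(x, y) \<in> r A \<or> (y, x) \<in> r A" by (auto simp: mem_r[OF A])
    qed
    moreover have "r A \<subseteq> g ` A \<times> g ` A" by (auto simp: r_def)
    ultimately show ?thesis
      by (simp add: well_order_on_def linear_order_on_def partial_order_on_def preorder_on_def
          Field_r)
  qed
  define \<phi> where "\<phi> a = abs_ordinal (r {b \<in> W. b < a})" for a
  have \<phi>_less: "\<phi> a < \<phi> b" if "a < b" "a \<in> W" "b \<in> W" for a b
  proof -
    let ?r = "r {c \<in> W. c < b}"
    have wob: "Well_order ?r" and woa: "Well_order (r {c \<in> W. c < a})" by (rule wo; blast)+
    have a: "g a \<in> Field ?r" using that by (auto simp: Field_r)
    have under: "underS ?r (g a) = g ` {c \<in> W. c < a}"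
    proof
      show "underS ?r (g a) \<subseteq> g ` {c \<in> W. c < a}"
      proof
        fix x assume x: "x \<in> underS ?r (g a)"
        then obtain c where c: "x = g c" "c \<in> W" "x \<noteq> g a" "(g c, g a) \<in> ?r"
          by (auto simp: underS_def r_def)
        then have "c \<le> a" "c \<noteq> a" using mem_r[of "{c \<in> W. c < b}" c a] that by auto
        then show "x \<in> g ` {c \<in> W. c < a}" using c by auto
      qed
      show "g ` {c \<in> W. c < a} \<subseteq> underS ?r (g a)"
        using that inj_onD[OF inj] by (fastforce simp: underS_def r_def)
    qed
    have "Restr ?r (underS ?r (g a)) = r {c \<in> W. c < a}"
    proof
      show "Restr ?r (underS ?r (g a)) \<subseteq> r {c \<in> W. c < a}"
      proof
        fix p assume p: "p \<in> Restr ?r (underS ?r (g a))"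
        then obtain c d where "p = (g c, g d)" "c \<in> W" "d \<in> W" "c < a" "d < a"
          unfolding under by auto
        then show "p \<in> r {c \<in> W. c < a}"
          using p mem_r[of "{c \<in> W. c < b}" c d] by (auto simp: r_def)
      qed
      show "r {c \<in> W. c < a} \<subseteq> Restr ?r (underS ?r (g a))"
        unfolding under using that by (fastforce simp: r_def)
    qed
    moreover have "Field ?r \<noteq> {}" using a by auto
    ultimately have "(r {c \<in> W. c < a}, ?r) \<in> ordLess"
      using underS_Restr_ordLess[OF wob, of "g a"] by simp
    then show ?thesis
      unfolding \<phi>_def using wob woa
      by (simp add: less_ordinal.abs_eq ordIso_reflexive)
  qed
  have main: "krull_class R (map_option \<phi> d) N"
    if "has_krull_dim R N d" for N :: "('a, 'm) module" and d :: "'o option"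
    using that
  proof (induction d arbitrary: N rule: less_induct)
    case (less d)
    have cl: "krull_class R d N" using less.prems by (simp add: has_krull_dim_def)
    show ?case
    proof (cases d)
      case None
      then show ?thesis using cl less.prems
        by (auto elim: krull_class.cases intro: krull_class.intros)
    next
      case (Some a)
      have aW: "a \<in> W" using less.prems Some by (auto simp: W_def)
      have rm: "right_module R N" using cl by (auto elim: krull_class.cases)
      have ch: "\<exists>n. \<forall>i\<ge>n. \<exists>\<beta> < Some a. \<exists>N' :: ('a, 'm) module.
          rmod_iso R (quot_module (N\<lparr>carrier := C i\<rparr>) (C (Suc i))) N' \<and> krull_class R \<beta> N'"
        if "(\<forall>i. submodule (C i) R N) \<and> (\<forall>i. C (Suc i) \<subseteq> C i)" for C :: "nat \<Rightarrow> 'm set"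
        using cl that unfolding Some krull_class_Some_iff by blast
      have step: "\<exists>\<gamma> < Some (\<phi> a). krull_class R \<gamma> N'"
        if b: "\<beta> < Some a" "krull_class R \<beta> N'" for \<beta> :: "'o option" and N' :: "('a, 'm) module"
      proof -
        define e where "e = (LEAST \<beta> :: 'o option. krull_class R \<beta> N')"
        have e: "has_krull_dim R N' e"
          unfolding has_krull_dim_def e_def using b(2) LeastI not_less_Least by metis
        have "e \<le> \<beta>" unfolding e_def using b(2) by (rule Least_le)
        then have lt: "e < Some a" using b(1) by (rule le_less_trans)
        then have "krull_class R (map_option \<phi> e) N'" using less.IH e Some by blast
        moreover have "map_option \<phi> e < Some (\<phi> a)"
        proof (cases e)
          case e': (Some c)
          then have "c \<in> W" using e by (auto simp: W_def)
          then have "\<phi> c < \<phi> a" using lt aW e' by (intro \<phi>_less) auto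
          then show ?thesis using e' by simp
        qed simp
        ultimately show ?thesis by blast
      qed
      have "krull_class R (Some (\<phi> a)) N"
      proof (rule krull_class.ordinal[OF rm], intro allI impI)
        fix C :: "nat \<Rightarrow> 'm set"
        assume C: "(\<forall>i. submodule (C i) R N) \<and> (\<forall>i. C (Suc i) \<subseteq> C i)"
        show "\<exists>n. \<forall>i\<ge>n. \<exists>\<gamma> < Some (\<phi> a). \<exists>N' :: ('a, 'm) module.
          rmod_iso R (quot_module (N\<lparr>carrier := C i\<rparr>) (C (Suc i))) N' \<and> krull_class R \<gamma> N'"
        proof -
          obtain n where n: "\<forall>i\<ge>n. \<exists>\<beta> < Some a. \<exists>N' :: ('a, 'm) module.
            rmod_iso R (quot_module (N\<lparr>carrier := C i\<rparr>) (C (Suc i))) N' \<and> krull_class R \<beta> N'"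
            using ch[OF C] by blast
          show ?thesis
          proof (intro exI[of _ n] allI impI)
            fix i assume "n \<le> i"
            with n obtain \<beta> :: "'o option" and N' :: "('a, 'm) module" where N': "\<beta> < Some a" "krull_class R \<beta> N'"
              "rmod_iso R (quot_module (N\<lparr>carrier := C i\<rparr>) (C (Suc i))) N'" by blast
            with step[OF N'(1,2)] show "\<exists>\<gamma> < Some (\<phi> a). \<exists>N' :: ('a, 'm) module.
              rmod_iso R (quot_module (N\<lparr>carrier := C i\<rparr>) (C (Suc i))) N' \<and> krull_class R \<gamma> N'"
              by blast
          qed
        qed
      qed
      then show ?thesis using Some less.prems by simp
    qed
  qed
  have "has_krull_dim R M (LEAST \<beta>. krull_class R \<beta> M :: 'o option)"
    unfolding has_krull_dim_def using assms LeastI not_less_Least by metis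
  then show ?thesis using main by blast
qed

text \<open>
  The ordinals of cardinality at most that of the type of modules on \<open>'m\<close> are enough to measure
  all modules on \<open>'m\<close>; see the lemma \<open>krull_class_any_wellorder\<close>.
\<close>

definition critical_module :: "('a, 'r) ring_scheme \<Rightarrow> ('a, 'm) module \<Rightarrow> bool" where
  "critical_module R M \<longleftrightarrow> (\<exists>\<alpha> :: ('a, 'm) module ordinal. critical_of_dim R \<alpha> M)"

definition cocritical :: "'a set \<Rightarrow> ('a, 'r) ring_scheme \<Rightarrow> bool" where
  "cocritical I R \<longleftrightarrow>
     right_ideal I R \<and> critical_module R (quot_module (regular_module R) I)"

end

theory Submission
  imports Defs
begin

text \<open>
  The family \<open>\<F>\<close> = \<^const>\<open>F_pr_circ\<close> satisfies the Oka condition: if \<open>I + aR\<close> and \<open>a\<^sup>-\<^sup>1 I\<close>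
  belong to \<open>\<F>\<close>, so does \<open>I\<close>.  Suppose \<open>\<F>\<close> contains a noetherian point annihilator set but not all
  right ideals.  Since members of \<open>\<F>\<close> are finitely generated, Zorn's lemma yields a right ideal \<open>I\<close>
  maximal outside \<open>\<F>\<close>.  All right ideals strictly above \<open>I\<close> are principal, so \<open>R/I\<close> is noetherian and
  some point annihilator \<open>a\<^sup>-\<^sup>1 I\<close> of it lies in \<open>\<F>\<close>; as \<open>I + aR\<close> is in \<open>\<F>\<close> by maximality, the Oka
  condition puts \<open>I\<close> in \<open>\<F>\<close>, a contradiction.

  The cocritical right ideals form a noetherian point annihilator set because a nonzero noetherian
  module has Krull dimension and therefore contains a critical cyclic submodule.  Krull dimension
  depends only on intervals of the submodule lattice, so these facts are purely order-theoretic.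
\<close>

section \<open>Krull dimension of intervals in an ordered set\<close>

text \<open>The recursion of \<open>krull_class\<close> with the interval from b up to a in the
  place of a module; the upper end is the first argument. A factor of a chain is again an interval
  of the same ordered set, so the recursion never leaves the type \<open>'p\<close>.\<close>

inductive krull_interval ::
  "'p::order set \<Rightarrow> 'o::wellorder option \<Rightarrow> 'p \<Rightarrow> 'p \<Rightarrow> bool" for L where
  minus_one: "krull_interval L None a a"
| ordinal: "(\<forall>C :: nat \<Rightarrow> 'p. (\<forall>i. C i \<in> L \<and> b \<le> C i \<and> C i \<le> a \<and> C (Suc i) \<le> C i) \<longrightarrow>
      (\<exists>n. \<forall>i\<ge>n. \<exists>\<beta> < Some \<alpha>. krull_interval L \<beta> (C i) (C (Suc i))))
    \<Longrightarrow> krull_interval L (Some \<alpha>) a b"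

lemma krull_interval_None_iff: "krull_interval L None a b \<longleftrightarrow> a = b"
  by (subst krull_interval.simps) auto

lemma krull_interval_Some_iff: "krull_interval L (Some \<alpha>) a b \<longleftrightarrow>
  (\<forall>C. (\<forall>i::nat. C i \<in> L \<and> b \<le> C i \<and> C i \<le> a \<and> C (Suc i) \<le> C i) \<longrightarrow>
      (\<exists>n. \<forall>i\<ge>n. \<exists>\<beta> < Some \<alpha>. krull_interval L \<beta> (C i) (C (Suc i))))"
  by (subst krull_interval.simps) simp

text \<open>A descending chain between b and a is sent by g to a descending chain between g b and g
  a, and the induction on \<alpha> pulls the bounds on its factors back. The conditions on g speak
  only of points of the interval, and injectivity only of comparable ones, so they pass to the
  factors.\<close>

lemma krull_interval_embed:
  fixes g :: "'q::order \<Rightarrow> 'p::order"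
  assumes "krull_interval L \<alpha> (g a) (g b)"
    and "a \<in> L'" "b \<in> L'" "b \<le> a"
    and into: "\<And>x. \<lbrakk>x \<in> L'; b \<le> x; x \<le> a\<rbrakk> \<Longrightarrow> g x \<in> L"
    and mono: "\<And>x y. \<lbrakk>x \<in> L'; y \<in> L'; b \<le> x; x \<le> y; y \<le> a\<rbrakk> \<Longrightarrow> g x \<le> g y"
    and inj: "\<And>x y. \<lbrakk>x \<in> L'; y \<in> L'; b \<le> x; x \<le> y; y \<le> a; g x = g y\<rbrakk> \<Longrightarrow> x = y"
  shows "krull_interval L' \<alpha> a b"
  using assms
proof (induction \<alpha> arbitrary: a b rule: less_induct)
  case (less \<alpha>)
  show ?case
  proof (cases \<alpha>)
    case None
    then have "g b = g a" using less.prems(1) by (simp add: krull_interval_None_iff)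
    then have "b = a" using less.prems(7)[of b a] less.prems(2-4) by simp
    then show ?thesis by (simp add: None krull_interval_None_iff)
  next
    case (Some \<gamma>)
    show ?thesis unfolding Some
    proof (rule krull_interval.ordinal, intro allI impI)
      fix C :: "nat \<Rightarrow> 'q"
      assume C: "\<forall>i. C i \<in> L' \<and> b \<le> C i \<and> C i \<le> a \<and> C (Suc i) \<le> C i"
      have 1: "\<forall>i. (g \<circ> C) i \<in> L \<and> g b \<le> (g \<circ> C) i \<and> (g \<circ> C) i \<le> g a \<and> (g \<circ> C) (Suc i) \<le> (g \<circ> C) i"
        using C less.prems(2-6) by (simp add: comp_def)
      obtain n where n: "\<And>i. i \<ge> n \<Longrightarrow> \<exists>\<beta> < Some \<gamma>. krull_interval L \<beta> (g (C i)) (g (C (Suc i)))"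
        using less.prems(1)[unfolded Some krull_interval_Some_iff, THEN spec[where x = "g \<circ> C"], THEN mp, OF 1]
        by auto
      have "\<exists>\<beta> < Some \<gamma>. krull_interval L' \<beta> (C i) (C (Suc i))" if "i \<ge> n" for i
      proof -
        obtain \<beta> where \<beta>: "\<beta> < Some \<gamma>" "krull_interval L \<beta> (g (C i)) (g (C (Suc i)))"
          using n[OF \<open>i \<ge> n\<close>] by blast
        have Ci: "C i \<in> L'" "C (Suc i) \<in> L'" "C (Suc i) \<le> C i" "b \<le> C (Suc i)" "C i \<le> a"
          using C by blast+
        have "krull_interval L' \<beta> (C i) (C (Suc i))"
        proof (rule less.IH)
          show "\<beta> < \<alpha>" using \<beta> Some by simp
          fix x assume "x \<in> L'" "C (Suc i) \<le> x" "x \<le> C i"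
          then show "g x \<in> L" using Ci less.prems(5) order_trans by blast
        next
          fix x y assume "x \<in> L'" "y \<in> L'" "C (Suc i) \<le> x" "x \<le> y" "y \<le> C i"
          then show "g x \<le> g y" using Ci less.prems(6)[of x y] order_trans by blast
        next
          fix x y assume "x \<in> L'" "y \<in> L'" "C (Suc i) \<le> x" "x \<le> y" "y \<le> C i" "g x = g y"
          then show "x = y" using Ci less.prems(7)[of x y] order_trans by blast
        qed (use Ci \<beta> in auto)
        then show ?thesis using \<beta> by blast
      qed
      then show "\<exists>n. \<forall>i\<ge>n. \<exists>\<beta> < Some \<gamma>. krull_interval L' \<beta> (C i) (C (Suc i))" by blast
    qed
  qed
qed

text \<open>A chain in the smaller interval is also a chain in the larger one; for -1 the two ends
  coincide and force the inner ends to coincide.\<close>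

lemma krull_interval_sub:
  assumes "krull_interval L \<alpha> a b" "b \<le> b'" "b' \<le> a'" "a' \<le> a"
  shows "krull_interval L \<alpha> a' b'"
proof (cases \<alpha>)
  case None
  then show ?thesis using assms by (auto simp: krull_interval_None_iff)
next
  case (Some \<gamma>)
  have "\<forall>i. C i \<in> L \<and> b \<le> C i \<and> C i \<le> a \<and> C (Suc i) \<le> C i"
    if "\<forall>i. C i \<in> L \<and> b' \<le> C i \<and> C i \<le> a' \<and> C (Suc i) \<le> C i" for C :: "nat \<Rightarrow> 'a"
    using that assms order_trans by blast
  then show ?thesis using assms(1) unfolding Some krull_interval_Some_iff by presburger
qed

text \<open>Well-order the type and send x to the order type of the initial segment strictly below
  x. This map is strictly increasing, hence injective, so there are enough ordinals for a
  cardinality argument.\<close>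

lemma inj_ordinal: "\<exists>h :: 'x \<Rightarrow> 'x ordinal. inj h"
proof -
  obtain w :: "'x rel" where w: "Well_order w" "Field w = UNIV"
    using well_order_on_Well_order well_ordering by (metis well_order_on_Field)
  define h where "h x = abs_ordinal (Restr w (underS w x))" for x
  have wR: "Well_order (Restr w A)" for A using w(1) by (rule Well_order_Restr)
  have less: "h x < h y" if "(x, y) \<in> w" "x \<noteq> y" for x y
  proof -
    let ?s = "Restr w (underS w y)"
    have "trans w" "antisym w"
      using w(1) by (auto simp: order_on_defs)
    then have sub: "underS w x \<subseteq> underS w y"
      using that by (auto simp: underS_def dest: transD antisymD)
    have x: "x \<in> underS w y" using that by (simp add: underS_def)
    have refl: "\<And>z. (z, z) \<in> w" using w by (auto simp: order_on_defs refl_on_def)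
    have F: "Field ?s \<noteq> {}" using x refl by (auto simp: Field_def)
    have u: "underS ?s x = underS w x" using sub x by (auto simp: underS_def)
    have xF: "x \<in> Field ?s" using x refl by (auto simp: Field_def)
    \<comment> \<open>The segment below x is a proper initial segment of the segment below y, so its
      order type is strictly smaller.\<close>
    have "Restr ?s (underS ?s x) = Restr w (underS w x)" unfolding u using sub by auto
    then have "(Restr w (underS w x), ?s) \<in> ordLess"
      using underS_Restr_ordLess[OF wR F] by metis
    then show ?thesis unfolding h_def using wR
      by (simp add: less_ordinal.abs_eq ordIso_reflexive)
  qed
  have "total_on UNIV w" using w by (simp add: order_on_defs)
  then have "inj h" using less unfolding total_on_def by (metis injI less_irrefl UNIV_I)
  then show ?thesis by blast
qed

text \<open>If no dimension existed, then maximal elements \<open>x\<close> for which \<open>[x, a]\<close> has no dimension below \<open>\<alpha>\<close>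
  would, as \<open>\<alpha>\<close> varies, inject the index type into \<open>'p\<close>, contradicting Cantor's theorem.\<close>

lemma krull_interval_exists:
  fixes L :: "'p::order set"
  assumes L: "a \<in> L" "b \<in> L" "b \<le> a"
    and acc: "\<And>X. X \<subseteq> L \<Longrightarrow> X \<noteq> {} \<Longrightarrow> \<exists>m \<in> X. \<forall>x \<in> X. \<not> m < x"
  shows "\<exists>\<alpha> :: 'p set ordinal option. krull_interval L \<alpha> a b"
proof (rule ccontr)
  assume "\<not> ?thesis"
  then have no: "\<not> krull_interval L \<alpha> a b" for \<alpha> :: "'p set ordinal option" by blast
  have "\<exists>x \<in> L. x \<le> a \<and> krull_interval L (Some \<alpha>) a x \<and> (\<forall>\<beta> < Some \<alpha>. \<not> krull_interval L \<beta> a x)"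
    for \<alpha> :: "'p set ordinal"
  proof -
    \<comment> \<open>The set contains b because the interval from b to a has no dimension at all. A
      maximal element m of it turns out to give dimension exactly \<alpha>.\<close>
    let ?X = "{x \<in> L. x \<le> a \<and> (\<forall>\<beta> < Some \<alpha>. \<not> krull_interval L \<beta> a x)}"
    have "b \<in> ?X" using L no by auto
    then obtain m where m: "m \<in> ?X" and max: "\<And>x. x \<in> ?X \<Longrightarrow> \<not> m < x"
      using acc[of ?X] by blast
    have "krull_interval L (Some \<alpha>) a m"
    proof (rule krull_interval.ordinal, intro allI impI)
      fix C :: "nat \<Rightarrow> 'p" assume C: "\<forall>i. C i \<in> L \<and> m \<le> C i \<and> C i \<le> a \<and> C (Suc i) \<le> C i"
      show "\<exists>n. \<forall>i\<ge>n. \<exists>\<beta> < Some \<alpha>. krull_interval L \<beta> (C i) (C (Suc i))"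
      \<comment> \<open>A chain that reaches m stays there, and its later factors are trivial, of
        class -1. Otherwise every \<open>C (Suc i)\<close> lies strictly above m, so maximality
        bounds the interval from it up to a, which contains the factor.\<close>
      proof (cases "\<exists>j. C j = m")
        case True
        then obtain j where j: "C j = m" by blast
        have anti: "C i \<le> C j" if "j \<le> i" for i
          using lift_Suc_antimono_le[of C, OF _ that] C by blast
        have "C i = m" if "j \<le> i" for i using anti[OF that] C j by (simp add: order_antisym)
        then have "\<forall>i\<ge>j. krull_interval L None (C i) (C (Suc i))"
          by (simp add: krull_interval_None_iff)
        then show ?thesis by (metis less_option_None_Some)
      next
        case False
        have "\<exists>\<beta> < Some \<alpha>. krull_interval L \<beta> (C i) (C (Suc i))" for i
        proof -
          have "m < C (Suc i)" using C False by (metis order_le_less)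
          then have "C (Suc i) \<notin> ?X" using max by blast
          then obtain \<beta> where "\<beta> < Some \<alpha>" "krull_interval L \<beta> a (C (Suc i))"
            using C by blast
          moreover have "krull_interval L \<beta> (C i) (C (Suc i))"
            using calculation(2) by (rule krull_interval_sub) (use C in auto)
          ultimately show ?thesis by blast
        qed
        then show ?thesis by blast
      qed
    qed
    then show ?thesis using m by blast
  qed
  then obtain f :: "'p set ordinal \<Rightarrow> 'p" where f:
    "\<And>\<alpha>. krull_interval L (Some \<alpha>) a (f \<alpha>)"
    "\<And>\<alpha> \<beta>. \<beta> < Some \<alpha> \<Longrightarrow> \<not> krull_interval L \<beta> a (f \<alpha>)"
    by metis
  have "inj f"
  proof (rule injI)
    fix \<alpha> \<beta> assume eq: "f \<alpha> = f \<beta>"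
    have "\<not> \<alpha> < \<beta>" "\<not> \<beta> < \<alpha>" using f eq by (metis less_option_Some)+
    then show "\<alpha> = \<beta>" by simp
  qed
  \<comment> \<open>The ordinals on \<open>'p set\<close> are at least as many as the subsets of
    \<open>'p\<close>, so \<open>f \<circ> h\<close> would embed the power set of \<open>'p\<close>
    in \<open>'p\<close>.\<close>
  moreover obtain h :: "'p set \<Rightarrow> 'p set ordinal" where "inj h" using inj_ordinal by blast
  ultimately have "inj (f \<circ> h)" by (simp add: inj_compose)
  then have "surj (inv_into UNIV (f \<circ> h))" by (rule inj_imp_surj_inv)
  then show False using Cantors_theorem by (metis (no_types) UNIV_I Pow_UNIV)
qed

text \<open>Order form of \<open>critical_of_dim\<close>: the quotient by a nonzero submodule
  becomes the interval from c to a with c above b. Lying in some class below \<alpha> stands for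
  having a dimension below \<alpha>, since a least class then exists.\<close>

definition critical_interval ::
  "'p::order set \<Rightarrow> 'o::wellorder \<Rightarrow> 'p \<Rightarrow> 'p \<Rightarrow> bool" where
  "critical_interval L \<alpha> a b \<longleftrightarrow> krull_interval L (Some \<alpha>) a b \<and>
     (\<forall>\<beta> < Some \<alpha>. \<not> krull_interval L \<beta> a b) \<and>
     (\<forall>c \<in> L. b < c \<and> c \<le> a \<longrightarrow> (\<exists>\<beta> < Some \<alpha>. krull_interval L \<beta> a c))"

text \<open>Take \<open>\<alpha>\<close> minimal among the dimensions of nonzero intervals \<open>[b, c]\<close>.  If none of those of
  dimension \<open>\<alpha>\<close> were critical, one could descend forever through factors of dimension \<open>\<alpha>\<close>.\<close>

lemma critical_interval_exists:
  fixes L :: "'p::order set" and \<gamma> :: "'o::wellorder option"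
  assumes "krull_interval L \<gamma> a b" "a \<in> L" "b < a"
  shows "\<exists>\<alpha>::'o. \<exists>c \<in> L. b < c \<and> c \<le> a \<and>
    (\<forall>d \<in> L. b < d \<and> d \<le> c \<longrightarrow> critical_interval L \<alpha> d b)"
proof -
  define P where "P \<alpha> \<longleftrightarrow> (\<exists>c \<in> L. b < c \<and> c \<le> a \<and> krull_interval L \<alpha> c b)" for \<alpha> :: "'o option"
  define \<delta> where "\<delta> = (LEAST \<alpha>. P \<alpha>)"
  have "P \<gamma>" using assms by (auto simp: P_def)
  then have "P \<delta>" unfolding \<delta>_def by (rule LeastI)
  then obtain c0 where c0: "c0 \<in> L" "b < c0" "c0 \<le> a" "krull_interval L \<delta> c0 b"
    by (auto simp: P_def)
  have least: "\<delta> \<le> \<beta>" if "c \<in> L" "b < c" "c \<le> a" "krull_interval L \<beta> c b" for c \<beta>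
    unfolding \<delta>_def by (rule Least_le) (use that in \<open>auto simp: P_def\<close>)
  obtain \<alpha> where \<alpha>: "\<delta> = Some \<alpha>"
    using c0 by (cases \<delta>) (auto simp: krull_interval_None_iff)
  have "\<exists>c \<in> L. b < c \<and> c \<le> c0 \<and> (\<forall>d \<in> L. b < d \<and> d \<le> c \<longrightarrow> (\<exists>\<beta> < \<delta>. krull_interval L \<beta> c d))"
  proof (rule ccontr)
    assume "\<not> ?thesis"
    then have "\<forall>c. \<exists>d. c \<in> L \<and> b < c \<and> c \<le> c0 \<longrightarrow>
        d \<in> L \<and> b < d \<and> d \<le> c \<and> (\<forall>\<beta> < \<delta>. \<not> krull_interval L \<beta> c d)"
      by meson
    then obtain s where s: "\<And>c. c \<in> L \<and> b < c \<and> c \<le> c0 \<Longrightarrow>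
        s c \<in> L \<and> b < s c \<and> s c \<le> c \<and> (\<forall>\<beta> < \<delta>. \<not> krull_interval L \<beta> c (s c))"
      by metis
    \<comment> \<open>Iterating s from c0 gives a descending chain above b none of whose factors has
      a class below \<delta>, although the interval from b to c0 has class \<delta>.\<close>
    define C where "C i = (s ^^ i) c0" for i
    have C: "C i \<in> L \<and> b < C i \<and> C i \<le> c0" for i
    proof (induction i)
      case 0
      then show ?case using c0 by (simp add: C_def)
    next
      case (Suc i)
      then show ?case using s[of "C i"] by (auto simp: C_def)
    qed
    have CS: "C (Suc i) = s (C i)" for i by (simp add: C_def)
    have ch: "\<forall>i. C i \<in> L \<and> b \<le> C i \<and> C i \<le> c0 \<and> C (Suc i) \<le> C i"
      using C s CS by (metis order_less_imp_le)
    then obtain n where "\<exists>\<beta> < \<delta>. krull_interval L \<beta> (C n) (C (Suc n))"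
      using c0(4) unfolding \<alpha> krull_interval_Some_iff by (metis order_refl)
    then show False using s[OF C[of n]] CS by auto
  qed
  then obtain c where c: "c \<in> L" "b < c" "c \<le> c0"
    "\<And>d. d \<in> L \<Longrightarrow> b < d \<Longrightarrow> d \<le> c \<Longrightarrow> \<exists>\<beta> < \<delta>. krull_interval L \<beta> c d" by blast
  \<comment> \<open>Criticality is inherited by every d between b and c: minimality of \<delta>
    fixes the dimension of the interval from b to d, and an interval from e to d is part of the one
    from e to c. This will permit passing to a cyclic submodule.\<close>
  have "critical_interval L \<alpha> d b" if d: "d \<in> L" "b < d" "d \<le> c" for d
    unfolding critical_interval_def \<alpha>[symmetric]
  proof (intro conjI allI impI ballI)
    show "krull_interval L \<delta> d b" using c0(4) by (rule krull_interval_sub) (use c d in auto)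
  next
    fix \<beta> assume "\<beta> < \<delta>"
    then show "\<not> krull_interval L \<beta> d b" using least[of d \<beta>] d c c0
      by (meson leD order_trans)
  next
    fix e assume "e \<in> L" "b < e \<and> e \<le> d"
    then obtain \<beta> where "\<beta> < \<delta>" "krull_interval L \<beta> c e" using c(4)[of e] d by (meson order_trans)
    moreover have "krull_interval L \<beta> d e"
      using calculation(2) by (rule krull_interval_sub) (use \<open>b < e \<and> e \<le> d\<close> d in auto)
    ultimately show "\<exists>\<beta> < \<delta>. krull_interval L \<beta> d e" by blast
  qed
  then show ?thesis using c c0 by (intro exI[of _ \<alpha>] bexI[of _ c]) auto
qed


section \<open>Epimorphisms of right modules\<close>

abbreviation submodules :: "('a, 'r) ring_scheme \<Rightarrow> ('a, 'm) module \<Rightarrow> 'm set set" where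
  "submodules R M \<equiv> {N. submodule N R M}"

section \<open>Submodules and their cosets\<close>

context right_module begin

lemma smult_r_null [simp]: "r \<in> carrier R \<Longrightarrow> r \<odot>\<^bsub>M\<^esub> \<zero>\<^bsub>M\<^esub> = \<zero>\<^bsub>M\<^esub>"
  using smult_r_distr[of r "\<zero>\<^bsub>M\<^esub>" "\<zero>\<^bsub>M\<^esub>"] M.add.l_cancel_one' by auto

lemma smult_l_null [simp]: "x \<in> carrier M \<Longrightarrow> \<zero> \<odot>\<^bsub>M\<^esub> x = \<zero>\<^bsub>M\<^esub>"
  using smult_l_distr[of \<zero> \<zero> x] M.add.l_cancel_one' by auto

lemma smult_minus_one: "x \<in> carrier M \<Longrightarrow> (\<ominus> \<one>) \<odot>\<^bsub>M\<^esub> x = \<ominus>\<^bsub>M\<^esub> x"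
  using smult_l_distr[of "\<ominus> \<one>" \<one> x] by (simp add: R.l_neg M.minus_equality)

lemma minus_eq_zero_iff:
  "\<lbrakk>x \<in> carrier M; y \<in> carrier M\<rbrakk> \<Longrightarrow> x \<ominus>\<^bsub>M\<^esub> y = \<zero>\<^bsub>M\<^esub> \<longleftrightarrow> x = y"
  using M.minus_equality[of x "\<ominus>\<^bsub>M\<^esub> y"] by (auto simp: a_minus_def M.r_neg)

lemma submodule_iff: "submodule N R M \<longleftrightarrow> N \<subseteq> carrier M \<and> \<zero>\<^bsub>M\<^esub> \<in> N \<and>
    (\<forall>x \<in> N. \<forall>y \<in> N. x \<oplus>\<^bsub>M\<^esub> y \<in> N) \<and> (\<forall>r \<in> carrier R. \<forall>x \<in> N. r \<odot>\<^bsub>M\<^esub> x \<in> N)" (is "_ \<longleftrightarrow> ?P")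
proof
  assume "submodule N R M"
  then interpret N: submodule N R M .
  show ?P using N.subset N.one_closed N.m_closed N.smult_closed by auto
next
  assume P: ?P
  \<comment> \<open>Additive inverses come from the action of
    \<open>\<ominus> \<one>\<close>.\<close>
  have "inv\<^bsub>add_monoid M\<^esub> x \<in> N" if "x \<in> N" for x
  proof -
    have "x \<in> carrier M" "(\<ominus> \<one>) \<odot>\<^bsub>M\<^esub> x \<in> N" using P that R.one_closed R.a_inv_closed by blast+
    then have "\<ominus>\<^bsub>M\<^esub> x \<in> N" by (simp add: smult_minus_one)
    then show ?thesis by (simp add: a_inv_def)
  qed
  then show "submodule N R M"
    using P by (intro submodule.intro subgroup.intro submodule_axioms.intro) auto
qed

lemma submoduleD:
  assumes "submodule N R M"
  shows submodule_subset: "N \<subseteq> carrier M" and submodule_zero: "\<zero>\<^bsub>M\<^esub> \<in> N"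
    and submodule_add: "\<lbrakk>x \<in> N; y \<in> N\<rbrakk> \<Longrightarrow> x \<oplus>\<^bsub>M\<^esub> y \<in> N"
    and submodule_smult: "\<lbrakk>r \<in> carrier R; x \<in> N\<rbrakk> \<Longrightarrow> r \<odot>\<^bsub>M\<^esub> x \<in> N"
  using assms unfolding submodule_iff by auto

lemma submodule_minus_closed:
  assumes "submodule N R M" "x \<in> N" "y \<in> N"
  shows "x \<ominus>\<^bsub>M\<^esub> y \<in> N"
proof -
  have "y \<in> carrier M" using assms(3) submodule_subset[OF assms(1)] by blast
  moreover have "(\<ominus> \<one>) \<odot>\<^bsub>M\<^esub> y \<in> N"
    using assms(1,3) by (intro submodule.smult_closed) auto
  ultimately have "\<ominus>\<^bsub>M\<^esub> y \<in> N" by (simp add: smult_minus_one)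
  then show ?thesis using submodule_add[OF assms(1)] assms(2) by (simp add: a_minus_def)
qed

lemma zero_submodule: "submodule {\<zero>\<^bsub>M\<^esub>} R M"
  by (simp add: submodule_iff)

lemma carrier_submodule: "submodule (carrier M) R M"
  by (simp add: submodule_iff)

lemma submodule_right_module:
  assumes "submodule N R M"
  shows "right_module R (M\<lparr>carrier := N\<rparr>)"
proof -
  interpret N: submodule N R M by fact
  have N: "N \<subseteq> carrier M" using N.subset by simp
  have "abelian_group (M\<lparr>carrier := N\<rparr>)"
  proof (rule abelian_groupI)
    fix x assume x: "x \<in> carrier (M\<lparr>carrier := N\<rparr>)"
    then have "\<ominus>\<^bsub>M\<^esub> x \<in> N" using N.m_inv_closed[of x] by (simp add: a_inv_def)
    then show "\<exists>y \<in> carrier (M\<lparr>carrier := N\<rparr>). y \<oplus>\<^bsub>M\<lparr>carrier := N\<rparr>\<^esub> x = \<zero>\<^bsub>M\<lparr>carrier := N\<rparr>\<^esub>"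
      using x N by (intro bexI[of _ "\<ominus>\<^bsub>M\<^esub> x"]) (simp_all add: subset_iff M.l_neg)
  qed (use N submoduleD[OF assms] in \<open>simp_all add: subset_iff M.a_ac\<close>)
  then show ?thesis
    using N submoduleD[OF assms]
    by (intro right_module.intro R.ring_axioms right_module_axioms.intro)
      (simp_all add: subset_iff smult_l_distr smult_r_distr smult_assoc)
qed

lemma submodules_restrict:
  assumes "submodule N R M"
  shows "submodule K R (M\<lparr>carrier := N\<rparr>) \<longleftrightarrow> submodule K R M \<and> K \<subseteq> N"
proof -
  interpret N: right_module R "M\<lparr>carrier := N\<rparr>" by (rule submodule_right_module) fact
  show ?thesis using assms unfolding N.submodule_iff submodule_iff by auto
qed

text \<open>Between B and A both lattices have the same members, so the identity embeds either
  interval in the other.\<close>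

lemma krull_interval_restrict:
  assumes "submodule N R M" "submodule A R M" "submodule B R M" "B \<subseteq> A" "A \<subseteq> N"
  shows "krull_interval (submodules R (M\<lparr>carrier := N\<rparr>)) \<alpha> A B \<longleftrightarrow>
    krull_interval (submodules R M) \<alpha> A B"
proof
  assume "krull_interval (submodules R (M\<lparr>carrier := N\<rparr>)) \<alpha> A B"
  then show "krull_interval (submodules R M) \<alpha> A B"
    by (rule krull_interval_embed[where g = "\<lambda>X. X"])
      (use assms in \<open>auto simp: submodules_restrict[OF assms(1)]\<close>)
next
  assume "krull_interval (submodules R M) \<alpha> A B"
  then show "krull_interval (submodules R (M\<lparr>carrier := N\<rparr>)) \<alpha> A B"
    by (rule krull_interval_embed[where g = "\<lambda>X. X"])
      (use assms in \<open>auto simp: submodules_restrict[OF assms(1)]\<close>)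
qed

lemma quot_coset_eq_iff:
  assumes "submodule N R M" "x \<in> carrier M" "y \<in> carrier M"
  shows "N +>\<^bsub>M\<^esub> x = N +>\<^bsub>M\<^esub> y \<longleftrightarrow> x \<ominus>\<^bsub>M\<^esub> y \<in> N"
proof -
  interpret N: abelian_subgroup N M by (rule submodule_abelian_subgroup) fact
  have "N +>\<^bsub>M\<^esub> x = N +>\<^bsub>M\<^esub> y \<longleftrightarrow> x \<in> N +>\<^bsub>M\<^esub> y"
    using assms N.a_rcos_self N.a_repr_independence' by metis
  also have "\<dots> \<longleftrightarrow> x \<ominus>\<^bsub>M\<^esub> y \<in> N"
    using N.a_rcos_module assms by (simp add: a_minus_def)
  finally show ?thesis .
qed

end

text \<open>Quotient maps and isomorphisms are both instances, so a single correspondence argument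
  serves for quotients and for isomorphic copies.\<close>

locale right_module_epi = M: right_module R M + N: right_module R N
  for R :: "('a, 'r) ring_scheme" (structure) and M :: "('a, 'm) module" and N :: "('a, 'n) module" +
  fixes f :: "'m \<Rightarrow> 'n"
  assumes surj: "f ` carrier M = carrier N"
    and hom_add: "\<lbrakk>x \<in> carrier M; y \<in> carrier M\<rbrakk> \<Longrightarrow> f (x \<oplus>\<^bsub>M\<^esub> y) = f x \<oplus>\<^bsub>N\<^esub> f y"
    and hom_smult: "\<lbrakk>r \<in> carrier R; x \<in> carrier M\<rbrakk> \<Longrightarrow> f (r \<odot>\<^bsub>M\<^esub> x) = r \<odot>\<^bsub>N\<^esub> f x"
begin

definition ker :: "'m set" where "ker = {x \<in> carrier M. f x = \<zero>\<^bsub>N\<^esub>}"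

lemma hom_closed [simp, intro]: "x \<in> carrier M \<Longrightarrow> f x \<in> carrier N"
  using surj by blast

lemma hom_zero [simp]: "f \<zero>\<^bsub>M\<^esub> = \<zero>\<^bsub>N\<^esub>"
  using hom_smult[of \<zero> "\<zero>\<^bsub>M\<^esub>"] by simp

lemma hom_a_inv: "x \<in> carrier M \<Longrightarrow> f (\<ominus>\<^bsub>M\<^esub> x) = \<ominus>\<^bsub>N\<^esub> f x"
  using hom_smult[of "\<ominus> \<one>" x] by (simp add: M.smult_minus_one N.smult_minus_one)

lemma hom_minus: "\<lbrakk>x \<in> carrier M; y \<in> carrier M\<rbrakk> \<Longrightarrow> f (x \<ominus>\<^bsub>M\<^esub> y) = f x \<ominus>\<^bsub>N\<^esub> f y"
  by (simp add: a_minus_def hom_add hom_a_inv)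

lemma image_submodule: "submodule A R M \<Longrightarrow> submodule (f ` A) R N"
  unfolding M.submodule_iff N.submodule_iff
  by (auto simp: hom_add[symmetric] hom_smult[symmetric] hom_zero[symmetric] subset_iff
      simp del: hom_zero intro!: imageI)

lemma vimage_submodule: "submodule D R N \<Longrightarrow> submodule {x \<in> carrier M. f x \<in> D} R M"
  unfolding M.submodule_iff N.submodule_iff by (auto simp: hom_add hom_smult)

lemma ker_submodule: "submodule ker R M"
  using vimage_submodule[OF N.zero_submodule] by (simp add: ker_def)

lemma eq_iff_minus_in_ker:
  "\<lbrakk>x \<in> carrier M; y \<in> carrier M\<rbrakk> \<Longrightarrow> f x = f y \<longleftrightarrow> x \<ominus>\<^bsub>M\<^esub> y \<in> ker"
  by (simp add: ker_def hom_minus N.minus_eq_zero_iff)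

lemma image_vimage: "D \<subseteq> carrier N \<Longrightarrow> f ` {x \<in> carrier M. f x \<in> D} = D"
  using surj by auto

text \<open>If f x = f y with y in A, then x - y lies in the kernel, hence in A, and so does x = (x
  - y) + y.\<close>

lemma vimage_image:
  assumes "submodule A R M" "ker \<subseteq> A"
  shows "{x \<in> carrier M. f x \<in> f ` A} = A"
proof -
  have A: "A \<subseteq> carrier M" using assms(1) by (rule M.submodule_subset)
  have "x \<in> A" if "x \<in> carrier M" "y \<in> A" "f x = f y" for x y
  proof -
    have "x \<ominus>\<^bsub>M\<^esub> y \<in> A" using that A assms(2) eq_iff_minus_in_ker[of x y] by blast
    then have "(x \<ominus>\<^bsub>M\<^esub> y) \<oplus>\<^bsub>M\<^esub> y \<in> A" using that by (intro M.submodule_add[OF assms(1)])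
    then show ?thesis using that A by (simp add: a_minus_def M.a_assoc subset_iff M.l_neg)
  qed
  then show ?thesis using A by auto
qed

text \<open>The correspondence theorem: taking images and taking preimages are order embeddings
  between the submodules above the kernel and the submodules of N, so
  \<open>krull_interval_embed\<close> applies in both directions.\<close>

lemma krull_interval_image_iff:
  assumes A: "submodule A R M" and B: "submodule B R M" and "ker \<subseteq> B" "B \<subseteq> A"
  shows "krull_interval (submodules R N) \<alpha> (f ` A) (f ` B) \<longleftrightarrow>
    krull_interval (submodules R M) \<alpha> A B"
proof
  assume "krull_interval (submodules R N) \<alpha> (f ` A) (f ` B)"
  then show "krull_interval (submodules R M) \<alpha> A B"
  proof (rule krull_interval_embed)
    fix x y assume *: "x \<in> submodules R M" "y \<in> submodules R M" "B \<subseteq> x" "x \<subseteq> y" "f ` x = f ` y"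
    have "{z \<in> carrier M. f z \<in> f ` x} = x" "{z \<in> carrier M. f z \<in> f ` y} = y"
      using * assms(3) by (intro vimage_image; blast)+
    then show "x = y" using *(5) by metis
  next
    fix x assume "x \<in> submodules R M"
    then show "f ` x \<in> submodules R N" using image_submodule by blast
  next
    fix x y :: "'m set" assume "x \<subseteq> y"
    then show "f ` x \<subseteq> f ` y" by (rule image_mono)
  qed (use A B \<open>B \<subseteq> A\<close> in simp_all)
next
  let ?g = "\<lambda>D. {x \<in> carrier M. f x \<in> D}"
  assume "krull_interval (submodules R M) \<alpha> A B"
  then have "krull_interval (submodules R M) \<alpha> (?g (f ` A)) (?g (f ` B))"
    using assms by (simp add: vimage_image)
  then show "krull_interval (submodules R N) \<alpha> (f ` A) (f ` B)"
  proof (rule krull_interval_embed)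
    fix x y assume *: "x \<in> submodules R N" "y \<in> submodules R N" "x \<subseteq> y" "?g x = ?g y"
    then have "x \<subseteq> carrier N" "y \<subseteq> carrier N" by (auto simp: N.submodule_iff)
    then show "x = y" using *(4) image_vimage by metis
  next
    fix x assume "x \<in> submodules R N"
    then show "?g x \<in> submodules R M" using vimage_submodule by blast
  next
    fix x y :: "'n set" assume "x \<subseteq> y"
    then show "?g x \<subseteq> ?g y" by blast
  next
    show "f ` B \<subseteq> f ` A" using \<open>B \<subseteq> A\<close> by (rule image_mono)
  qed (use A B image_submodule in simp_all)
qed

lemma krull_interval_whole_iff:
  "krull_interval (submodules R N) \<alpha> (carrier N) {\<zero>\<^bsub>N\<^esub>} \<longleftrightarrow>
    krull_interval (submodules R M) \<alpha> (carrier M) ker"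
proof -
  have "ker \<noteq> {}" using M.submodule_zero[OF ker_submodule] by blast
  then have "f ` ker = {\<zero>\<^bsub>N\<^esub>}" by (auto simp: ker_def)
  moreover have "ker \<subseteq> carrier M" by (auto simp: ker_def)
  ultimately show ?thesis
    using krull_interval_image_iff[OF M.carrier_submodule ker_submodule] surj by auto
qed

lemma first_isomorphism: "rmod_iso R (quot_module M ker) N"
proof -
  \<comment> \<open>A value of f at a chosen representative; by \<open>cos\<close> it does not
    depend on the choice.\<close>
  define g where "g X = f (SOME x. x \<in> carrier M \<and> X = ker +>\<^bsub>M\<^esub> x)" for X
  have cos: "ker +>\<^bsub>M\<^esub> x = ker +>\<^bsub>M\<^esub> y \<longleftrightarrow> f x = f y" if "x \<in> carrier M" "y \<in> carrier M" for x y
    using M.quot_coset_eq_iff[OF ker_submodule that] eq_iff_minus_in_ker[OF that] by simp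
  have g: "g (ker +>\<^bsub>M\<^esub> x) = f x" if "x \<in> carrier M" for x
  proof -
    have "\<exists>y. y \<in> carrier M \<and> ker +>\<^bsub>M\<^esub> x = ker +>\<^bsub>M\<^esub> y" using that by blast
    from someI_ex[OF this] show ?thesis unfolding g_def using cos[OF that] by metis
  qed
  have car: "carrier (quot_module M ker) = (\<lambda>x. ker +>\<^bsub>M\<^esub> x) ` carrier M"
    by (auto simp: A_RCOSETS_def')
  interpret K: abelian_subgroup ker M using M.submodule_abelian_subgroup[OF ker_submodule] .
  have "bij_betw g (carrier (quot_module M ker)) (carrier N)"
    unfolding bij_betw_def inj_on_def car using surj by (auto simp: g cos image_image)
  moreover have "g ((ker +>\<^bsub>M\<^esub> x) \<oplus>\<^bsub>quot_module M ker\<^esub> (ker +>\<^bsub>M\<^esub> y))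
      = g (ker +>\<^bsub>M\<^esub> x) \<oplus>\<^bsub>N\<^esub> g (ker +>\<^bsub>M\<^esub> y)" if "x \<in> carrier M" "y \<in> carrier M" for x y
    using that by (simp add: K.a_rcos_sum g hom_add)
  moreover have "g (r \<odot>\<^bsub>quot_module M ker\<^esub> (ker +>\<^bsub>M\<^esub> x)) = r \<odot>\<^bsub>N\<^esub> g (ker +>\<^bsub>M\<^esub> x)"
    if "x \<in> carrier M" "r \<in> carrier R" for x r
    using that by (simp add: M.quot_smult_coset[OF ker_submodule] g hom_smult)
  ultimately show ?thesis unfolding rmod_iso_def car by (intro exI[of _ g]) auto
qed

end

lemma rmod_iso_epi:
  assumes "rmod_iso R M N" "right_module R M" "right_module R N"
  obtains f where "right_module_epi R M N f" "inj_on f (carrier M)"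
proof -
  obtain f where f: "bij_betw f (carrier M) (carrier N)"
    "\<forall>x \<in> carrier M. \<forall>y \<in> carrier M. f (x \<oplus>\<^bsub>M\<^esub> y) = f x \<oplus>\<^bsub>N\<^esub> f y"
    "\<forall>r \<in> carrier R. \<forall>x \<in> carrier M. f (r \<odot>\<^bsub>M\<^esub> x) = r \<odot>\<^bsub>N\<^esub> f x"
    using assms(1) unfolding rmod_iso_def by blast
  have "right_module_epi R M N f"
    using f by (intro right_module_epi.intro right_module_epi_axioms.intro assms(2,3))
      (auto simp: bij_betw_def)
  then show thesis using that f(1) by (auto simp: bij_betw_def)
qed

lemma right_module_epi_inj_ker:
  assumes "right_module_epi R M N f" "inj_on f (carrier M)"
  shows "right_module_epi.ker M N f = {\<zero>\<^bsub>M\<^esub>}"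
proof -
  interpret right_module_epi R M N f by fact
  have "f x = \<zero>\<^bsub>N\<^esub> \<longleftrightarrow> x = \<zero>\<^bsub>M\<^esub>" if "x \<in> carrier M" for x
    using inj_on_eq_iff[OF assms(2) that M.M.zero_closed] by simp
  then show ?thesis unfolding ker_def by auto
qed

lemma rmod_iso_sym:
  assumes "rmod_iso R M N" "right_module R M" "right_module R N"
  shows "rmod_iso R N M"
proof -
  interpret M: right_module R M by fact
  obtain f where f: "bij_betw f (carrier M) (carrier N)"
    "\<And>x y. \<lbrakk>x \<in> carrier M; y \<in> carrier M\<rbrakk> \<Longrightarrow> f (x \<oplus>\<^bsub>M\<^esub> y) = f x \<oplus>\<^bsub>N\<^esub> f y"
    "\<And>r x. \<lbrakk>r \<in> carrier R; x \<in> carrier M\<rbrakk> \<Longrightarrow> f (r \<odot>\<^bsub>M\<^esub> x) = r \<odot>\<^bsub>N\<^esub> f x"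
    using assms(1) unfolding rmod_iso_def by blast
  define g where "g = inv_into (carrier M) f"
  have g: "bij_betw g (carrier N) (carrier M)"
    "\<And>y. y \<in> carrier N \<Longrightarrow> f (g y) = y" "\<And>x. x \<in> carrier M \<Longrightarrow> g (f x) = x"
    "\<And>y. y \<in> carrier N \<Longrightarrow> g y \<in> carrier M"
    unfolding g_def using f(1) bij_betw_inv_into[OF f(1)]
    by (auto simp: bij_betw_inv_into_left bij_betw_inv_into_right dest: bij_betwE)
  have "g (x \<oplus>\<^bsub>N\<^esub> y) = g x \<oplus>\<^bsub>M\<^esub> g y" if "x \<in> carrier N" "y \<in> carrier N" for x y
    using f(2)[of "g x" "g y"] g that by (metis M.M.add.m_closed)
  moreover have "g (r \<odot>\<^bsub>N\<^esub> x) = r \<odot>\<^bsub>M\<^esub> g x" if "r \<in> carrier R" "x \<in> carrier N" for r x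
    using f(3)[of r "g x"] g that by (metis M.smult_closed)
  ultimately show ?thesis using g(1) unfolding rmod_iso_def by blast
qed

lemma (in right_module) quot_epi:
  assumes "submodule N R M"
  shows "right_module_epi R M (quot_module M N) (\<lambda>x. N +>\<^bsub>M\<^esub> x)"
    and "right_module_epi.ker M (quot_module M N) (\<lambda>x. N +>\<^bsub>M\<^esub> x) = N"
proof -
  interpret N: abelian_subgroup N M using submodule_abelian_subgroup[OF assms] .
  interpret Q: right_module R "quot_module M N" by (rule quot_right_module[OF assms])
  show *: "right_module_epi R M (quot_module M N) (\<lambda>x. N +>\<^bsub>M\<^esub> x)"
    by unfold_locales (auto simp: A_RCOSETS_def' N.a_rcos_sum quot_smult_coset[OF assms])
  have "N +>\<^bsub>M\<^esub> x = N \<longleftrightarrow> x \<in> N" if "x \<in> carrier M" for x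
    using that N.a_rcos_self N.a_rcos_const by metis
  then show "right_module_epi.ker M (quot_module M N) (\<lambda>x. N +>\<^bsub>M\<^esub> x) = N"
    unfolding right_module_epi.ker_def[OF *] using submodule_subset[OF assms] by auto
qed

text \<open>The operations are conjugated by \<phi>, so that its image becomes a module on another
  type.\<close>

lemma rmod_iso_transport:
  fixes Q :: "('a, 'm) module" and \<phi> :: "'m \<Rightarrow> 'n"
  assumes "right_module R Q" "inj_on \<phi> (carrier Q)"
  shows "\<exists>N :: ('a, 'n) module. right_module R N \<and> rmod_iso R Q N"
proof -
  interpret Q: right_module R Q by fact
  define \<psi> where "\<psi> = inv_into (carrier Q) \<phi>"
  have \<psi> [simp]: "\<psi> (\<phi> x) = x" if "x \<in> carrier Q" for x
    using that assms(2) by (simp add: \<psi>_def)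
  define N :: "('a, 'n) module" where "N = \<lparr>carrier = \<phi> ` carrier Q, mult = undefined,
     one = undefined, zero = \<phi> \<zero>\<^bsub>Q\<^esub>, add = (\<lambda>x y. \<phi> (\<psi> x \<oplus>\<^bsub>Q\<^esub> \<psi> y)),
     smult = (\<lambda>r x. \<phi> (r \<odot>\<^bsub>Q\<^esub> \<psi> x))\<rparr>"
  have "abelian_group N"
  proof (rule abelian_groupI)
    fix x assume "x \<in> carrier N"
    then obtain y where y: "y \<in> carrier Q" "x = \<phi> y" by (auto simp: N_def)
    then have "\<phi> (\<ominus>\<^bsub>Q\<^esub> y) \<in> carrier N" "\<phi> (\<ominus>\<^bsub>Q\<^esub> y) \<oplus>\<^bsub>N\<^esub> x = \<zero>\<^bsub>N\<^esub>"
      by (simp_all add: N_def Q.M.l_neg)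
    then show "\<exists>z \<in> carrier N. z \<oplus>\<^bsub>N\<^esub> x = \<zero>\<^bsub>N\<^esub>" by blast
  qed (auto simp: N_def Q.M.a_assoc intro!: arg_cong[of _ _ \<phi>] Q.M.a_comm)
  then have "right_module R N"
    by (intro right_module.intro Q.R.ring_axioms right_module_axioms.intro)
      (auto simp: N_def Q.smult_l_distr Q.smult_r_distr Q.smult_assoc)
  moreover have "rmod_iso R Q N"
    unfolding rmod_iso_def using assms(2) by (intro exI[of _ \<phi>]) (auto simp: N_def bij_betw_def)
  ultimately show ?thesis by blast
qed

text \<open>Choosing a representative of each coset injects the quotient into M. The result is the
  copy on the original type that the recursion of \<open>krull_class\<close> asks for.\<close>

lemma (in right_module) quot_rmod_iso_same_type:
  assumes "submodule N R M"
  shows "\<exists>N' :: ('a, 'm) module. right_module R N' \<and> rmod_iso R (quot_module M N) N'"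
proof (rule rmod_iso_transport)
  show "right_module R (quot_module M N)" by (rule quot_right_module) fact
  interpret N: abelian_subgroup N M using submodule_abelian_subgroup[OF assms] .
  have "\<exists>x. x \<in> carrier M \<and> X = N +>\<^bsub>M\<^esub> x" if "X \<in> carrier (quot_module M N)" for X
    using that by (auto simp: A_RCOSETS_def')
  then have "X = N +>\<^bsub>M\<^esub> (SOME x. x \<in> carrier M \<and> X = N +>\<^bsub>M\<^esub> x)"
    if "X \<in> carrier (quot_module M N)" for X
    using someI_ex[of "\<lambda>x. x \<in> carrier M \<and> X = N +>\<^bsub>M\<^esub> x"] that by blast
  then show "inj_on (\<lambda>X. SOME x. x \<in> carrier M \<and> X = N +>\<^bsub>M\<^esub> x) (carrier (quot_module M N))"
    by (metis (no_types, lifting) inj_onI)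
qed


section \<open>Critical modules\<close>

lemma rmod_iso_krull_interval_iff:
  assumes "rmod_iso R M N" "right_module R M" "right_module R N"
  shows "krull_interval (submodules R N) \<alpha> (carrier N) {\<zero>\<^bsub>N\<^esub>} \<longleftrightarrow>
    krull_interval (submodules R M) \<alpha> (carrier M) {\<zero>\<^bsub>M\<^esub>}"
proof -
  obtain f where f: "right_module_epi R M N f" "inj_on f (carrier M)"
    using assms by (rule rmod_iso_epi)
  then show ?thesis
    using right_module_epi.krull_interval_whole_iff[OF f(1)] right_module_epi_inj_ker[OF f] by simp
qed

lemma (in right_module) krull_interval_quot_iff:
  assumes "submodule N R M"
  shows "krull_interval (submodules R (quot_module M N)) \<alpha> (carrier (quot_module M N)) {N} \<longleftrightarrow>
    krull_interval (submodules R M) \<alpha> (carrier M) N"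
  using right_module_epi.krull_interval_whole_iff[OF quot_epi(1)[OF assms]] quot_epi(2)[OF assms]
  by (simp del: quot_module_simps(1,3))

text \<open>N is a copy of A/B, whose submodules correspond to the submodules of A above B; these
  form the interval from B to A in the lattice of M.\<close>

lemma (in right_module) krull_interval_factor_iff:
  assumes "submodule A R M" "submodule B R M" "B \<subseteq> A"
    and iso: "rmod_iso R (quot_module (M\<lparr>carrier := A\<rparr>) B) N" and N: "right_module R N"
  shows "krull_interval (submodules R N) \<alpha> (carrier N) {\<zero>\<^bsub>N\<^esub>} \<longleftrightarrow>
    krull_interval (submodules R M) \<alpha> A B"
proof -
  interpret A: right_module R "M\<lparr>carrier := A\<rparr>" by (rule submodule_right_module) fact
  have B: "submodule B R (M\<lparr>carrier := A\<rparr>)" using assms submodules_restrict by blast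
  have "krull_interval (submodules R N) \<alpha> (carrier N) {\<zero>\<^bsub>N\<^esub>} \<longleftrightarrow>
      krull_interval (submodules R (M\<lparr>carrier := A\<rparr>)) \<alpha> A B"
    using rmod_iso_krull_interval_iff[OF iso A.quot_right_module[OF B] N, of \<alpha>]
      A.krull_interval_quot_iff[OF B, of \<alpha>]
    by (simp del: quot_module_simps(1,3))
  also have "\<dots> \<longleftrightarrow> krull_interval (submodules R M) \<alpha> A B"
    using assms by (intro krull_interval_restrict) auto
  finally show ?thesis .
qed

text \<open>The bridge from modules to the order-theoretic results, by induction on \<alpha>: each
  factor A/B in a chain is traded for the interval from B to A.\<close>

lemma krull_class_iff:
  fixes M :: "('a, 'm) module" and \<alpha> :: "'o::wellorder option"
  assumes "right_module R M"
  shows "krull_class R \<alpha> M \<longleftrightarrow> krull_interval (submodules R M) \<alpha> (carrier M) {\<zero>\<^bsub>M\<^esub>}"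
  using assms
proof (induction \<alpha> arbitrary: M rule: less_induct)
  case (less \<alpha> M)
  interpret right_module R M by fact
  show ?case
  proof (cases \<alpha>)
    case None
    have "krull_class R None M \<longleftrightarrow> zero_module M"
      using less.prems by (subst krull_class.simps) auto
    then show ?thesis by (simp add: None krull_interval_None_iff zero_module_def)
  next
    case (Some \<gamma>)
    \<comment> \<open>Every N isomorphic to A/B lies in exactly the classes of the interval, by
      induction; that one exists on the right type is needed to return from the interval to a
      module.\<close>
    have factor: "(\<exists>N :: ('a, 'm) module.
        rmod_iso R (quot_module (M\<lparr>carrier := A\<rparr>) B) N \<and> krull_class R \<beta> N) \<longleftrightarrow>
        krull_interval (submodules R M) \<beta> A B" (is "?P \<longleftrightarrow> ?Q")
      if "\<beta> < Some \<gamma>" and AB: "submodule A R M" "submodule B R M" "B \<subseteq> A" for A B \<beta>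
    proof -
      have iff: "krull_class R \<beta> N \<longleftrightarrow> ?Q"
        if "right_module R N" "rmod_iso R (quot_module (M\<lparr>carrier := A\<rparr>) B) N"
        for N :: "('a, 'm) module"
        using less.IH[of \<beta> N] krull_interval_factor_iff[OF AB that(2,1)] that(1) Some \<open>\<beta> < Some \<gamma>\<close>
        by simp
      interpret A: right_module R "M\<lparr>carrier := A\<rparr>" by (rule submodule_right_module) fact
      have "submodule B R (M\<lparr>carrier := A\<rparr>)" using AB submodules_restrict by blast
      then obtain N :: "('a, 'm) module" where N: "right_module R N"
        "rmod_iso R (quot_module (M\<lparr>carrier := A\<rparr>) B) N"
        using A.quot_rmod_iso_same_type by blast
      have rm: "right_module R N" if "krull_class R \<beta> N" for N :: "('a, 'm) module"
        using that by (auto elim: krull_class.cases)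
      show ?thesis using iff N rm by blast
    qed
    have chain: "(\<forall>i. submodule (C i) R M) \<and> (\<forall>i. C (Suc i) \<subseteq> C i) \<longleftrightarrow>
        (\<forall>i. C i \<in> submodules R M \<and> {\<zero>\<^bsub>M\<^esub>} \<subseteq> C i \<and> C i \<subseteq> carrier M \<and> C (Suc i) \<subseteq> C i)"
      for C :: "nat \<Rightarrow> 'm set"
      using submodule_zero submodule_subset by auto
    have "(\<exists>n. \<forall>i\<ge>n. \<exists>\<beta><Some \<gamma>. \<exists>N :: ('a, 'm) module.
          rmod_iso R (quot_module (M\<lparr>carrier := C i\<rparr>) (C (Suc i))) N \<and> krull_class R \<beta> N) \<longleftrightarrow>
        (\<exists>n. \<forall>i\<ge>n. \<exists>\<beta><Some \<gamma>. krull_interval (submodules R M) \<beta> (C i) (C (Suc i)))"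
      if "(\<forall>i. submodule (C i) R M) \<and> (\<forall>i. C (Suc i) \<subseteq> C i)" for C
      using factor that by (simp cong: conj_cong)
    then show ?thesis
      unfolding Some krull_class_Some_iff krull_interval_Some_iff chain[symmetric]
      using less.prems by auto
  qed
qed

lemma (in right_module) critical_of_dim_iff:
  fixes \<alpha> :: "'o::wellorder"
  shows "critical_of_dim R \<alpha> M \<longleftrightarrow> critical_interval (submodules R M) \<alpha> (carrier M) {\<zero>\<^bsub>M\<^esub>}"
proof -
  have rm: "right_module R M" by (rule right_module_axioms)
  have quot: "(\<exists>\<beta> < Some \<alpha>. has_krull_dim R (quot_module M N) \<beta>) \<longleftrightarrow>
      (\<exists>\<beta> < Some \<alpha>. krull_interval (submodules R M) \<beta> (carrier M) N)" if "submodule N R M" for N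
  proof -
    have "(\<exists>\<beta> < Some \<alpha>. has_krull_dim R (quot_module M N) \<beta>) \<longleftrightarrow>
        (\<exists>\<beta> < Some \<alpha>. krull_class R \<beta> (quot_module M N))"
    proof
      assume "\<exists>\<beta> < Some \<alpha>. krull_class R \<beta> (quot_module M N)"
      then obtain \<beta> where \<beta>: "\<beta> < Some \<alpha>" "krull_class R \<beta> (quot_module M N)" by blast
      \<comment> \<open>The least class containing the quotient is its Krull dimension, and it does
        not exceed \<beta>.\<close>
      define d where "d = (LEAST \<beta> :: 'o option. krull_class R \<beta> (quot_module M N))"
      have "has_krull_dim R (quot_module M N) d"
        unfolding has_krull_dim_def d_def
        using LeastI[of "\<lambda>\<beta>. krull_class R \<beta> (quot_module M N)", OF \<beta>(2)]
          not_less_Least[of _ "\<lambda>\<beta>. krull_class R \<beta> (quot_module M N)"] by blast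
      moreover have "d \<le> \<beta>" unfolding d_def using \<beta>(2) by (rule Least_le)
      ultimately show "\<exists>\<beta> < Some \<alpha>. has_krull_dim R (quot_module M N) \<beta>"
        using \<beta>(1) le_less_trans by blast
    qed (auto simp: has_krull_dim_def)
    then show ?thesis
      unfolding krull_class_iff[OF quot_right_module[OF that]] quot_module_simps(2)
        krull_interval_quot_iff[OF that] .
  qed
  have ne: "{\<zero>\<^bsub>M\<^esub>} < N \<and> N \<subseteq> carrier M \<longleftrightarrow> N \<noteq> {\<zero>\<^bsub>M\<^esub>}" if "submodule N R M" for N
    using submoduleD[OF that] by auto
  show ?thesis
    unfolding critical_of_dim_def critical_interval_def has_krull_dim_def[of R M] krull_class_iff[OF rm]
    using quot ne rm by auto
qed

text \<open>A nonzero submodule c of N has a nonzero preimage c' in M, and the intervals above c and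
  above c' have the same classes; so the bound on M/c' carries over to N/c.\<close>

lemma rmod_iso_critical_of_dim:
  assumes iso: "rmod_iso R M N" and M: "right_module R M" and N: "right_module R N"
    and crit: "critical_of_dim R \<alpha> M"
  shows "critical_of_dim R \<alpha> N"
proof -
  obtain f where f: "right_module_epi R M N f" "inj_on f (carrier M)"
    using iso M N by (rule rmod_iso_epi)
  interpret right_module_epi R M N f by fact
  have ker: "ker = {\<zero>\<^bsub>M\<^esub>}" using f by (rule right_module_epi_inj_ker)
  have M_crit: "critical_interval (submodules R M) \<alpha> (carrier M) {\<zero>\<^bsub>M\<^esub>}"
    using crit M.critical_of_dim_iff by blast
  have "\<exists>\<beta> < Some \<alpha>. krull_interval (submodules R N) \<beta> (carrier N) c"
    if c: "submodule c R N" "{\<zero>\<^bsub>N\<^esub>} < c" for c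
  proof -
    define c' where "c' = {x \<in> carrier M. f x \<in> c}"
    have c'_sub: "submodule c' R M" unfolding c'_def using c(1) by (rule vimage_submodule)
    have "f ` c' = c" unfolding c'_def using N.submodule_subset[OF c(1)] by (rule image_vimage)
    moreover have c'_car: "c' \<subseteq> carrier M" by (auto simp: c'_def)
    moreover have zero: "{\<zero>\<^bsub>M\<^esub>} \<subseteq> c'" using M.submodule_zero[OF c'_sub] by simp
    moreover have "c' \<noteq> {\<zero>\<^bsub>M\<^esub>}" using \<open>f ` c' = c\<close> c(2) by auto
    then obtain \<beta> where "\<beta> < Some \<alpha>" "krull_interval (submodules R M) \<beta> (carrier M) c'"
      using M_crit c'_sub c'_car zero unfolding critical_interval_def by blast
    ultimately show ?thesis
      using krull_interval_image_iff[OF M.carrier_submodule c'_sub, of \<beta>] ker surj by auto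
  qed
  then have "critical_interval (submodules R N) \<alpha> (carrier N) {\<zero>\<^bsub>N\<^esub>}"
    using M_crit unfolding critical_interval_def krull_interval_whole_iff ker by simp
  then show ?thesis using N.critical_of_dim_iff by blast
qed

section \<open>Critical cyclic submodules of noetherian modules\<close>

lemma noetherian_module_maximal:
  assumes "noetherian_module R M" "X \<subseteq> submodules R M" "X \<noteq> {}"
  shows "\<exists>m \<in> X. \<forall>x \<in> X. \<not> m < x"
proof (rule ccontr)
  assume "\<not> ?thesis"
  then have "\<forall>m. \<exists>x. m \<in> X \<longrightarrow> x \<in> X \<and> m < x" by blast
  \<comment> \<open>Iterating the choice of a larger member would give a strictly ascending chain of
    submodules.\<close>
  then obtain s where s: "\<And>m. m \<in> X \<Longrightarrow> s m \<in> X \<and> m < s m" by metis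
  obtain c0 where "c0 \<in> X" using assms(3) by blast
  define C where "C i = (s ^^ i) c0" for i
  have C: "C i \<in> X" for i by (induction i) (auto simp: C_def \<open>c0 \<in> X\<close> s)
  have less: "C i < C (Suc i)" for i using s[OF C[of i]] by (simp add: C_def)
  then have "\<forall>i. submodule (C i) R M" "\<forall>i. C i \<subseteq> C (Suc i)" using C assms(2) by auto
  then obtain n where "\<forall>i\<ge>n. C i = C n"
    using assms(1) unfolding noetherian_module_def by blast
  then have "C (Suc n) = C n" using le_SucI by blast
  then show False using less[of n] by simp
qed

context right_module begin

text \<open>With \<open>first_isomorphism\<close> this yields R/ann(x) \<cong> xR, which links point
  annihilators to cyclic submodules.\<close>

lemma cyclic_epi:
  assumes x: "x \<in> carrier M"
  defines "X \<equiv> (\<lambda>r. r \<odot>\<^bsub>M\<^esub> x) ` carrier R"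
  shows "submodule X R M" "x \<in> X"
    and "right_module_epi R (regular_module R) (M\<lparr>carrier := X\<rparr>) (\<lambda>r. r \<odot>\<^bsub>M\<^esub> x)"
    and "right_module_epi.ker (regular_module R) (M\<lparr>carrier := X\<rparr>) (\<lambda>r. r \<odot>\<^bsub>M\<^esub> x)
      = annihilator R M x"
proof -
  have "\<zero>\<^bsub>M\<^esub> \<in> X" unfolding X_def using x by (metis R.zero_closed imageI smult_l_null)
  moreover have "a \<oplus>\<^bsub>M\<^esub> b \<in> X" if "a \<in> X" "b \<in> X" for a b
    using that x by (auto simp: X_def smult_l_distr[symmetric])
  moreover have "r \<odot>\<^bsub>M\<^esub> a \<in> X" if "a \<in> X" "r \<in> carrier R" for a r
    using that x by (auto simp: X_def smult_assoc[symmetric])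
  ultimately show sub: "submodule X R M"
    using x by (auto simp: submodule_iff X_def)
  show "x \<in> X" unfolding X_def using x by (metis R.one_closed imageI smult_one)
  interpret X: right_module R "M\<lparr>carrier := X\<rparr>" by (rule submodule_right_module) fact
  interpret Rg: right_module R "regular_module R" by (rule R.regular_right_module)
  show epi: "right_module_epi R (regular_module R) (M\<lparr>carrier := X\<rparr>) (\<lambda>r. r \<odot>\<^bsub>M\<^esub> x)"
    by unfold_locales (use x in \<open>simp_all add: regular_module_def X_def smult_l_distr smult_assoc\<close>)
  show "right_module_epi.ker (regular_module R) (M\<lparr>carrier := X\<rparr>) (\<lambda>r. r \<odot>\<^bsub>M\<^esub> x)
      = annihilator R M x"
    unfolding right_module_epi.ker_def[OF epi] by (simp add: annihilator_def regular_module_def)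
qed

lemma annihilator_right_ideal:
  "x \<in> carrier M \<Longrightarrow> right_ideal (annihilator R M x) R"
  using right_module_epi.ker_submodule[OF cyclic_epi(3)] cyclic_epi(4)
  by (simp add: R.submodule_regular_iff)

lemma noetherian_cocritical_annihilator:
  assumes noeth: "noetherian_module R M" and nz: "\<not> zero_module M"
  shows "\<exists>x \<in> carrier M. x \<noteq> \<zero>\<^bsub>M\<^esub> \<and> (\<exists>\<alpha> :: ('a, 'm) module ordinal.
    critical_of_dim R \<alpha> (quot_module (regular_module R) (annihilator R M x)))"
proof -
  let ?L = "submodules R M"
  have rm: "right_module R M" by (rule right_module_axioms)
  \<comment> \<open>Points of the lattice have type \<open>'m set\<close>, so its dimension is found
    among the ordinals on \<open>'m set set\<close>. It is then exchanged for an ordinal of the type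
    used in \<open>critical_module\<close>.\<close>
  have "\<exists>\<alpha> :: 'm set set ordinal option. krull_interval ?L \<alpha> (carrier M) {\<zero>\<^bsub>M\<^esub>}"
    using noetherian_module_maximal[OF noeth] carrier_submodule zero_submodule
    by (intro krull_interval_exists) auto
  then obtain \<alpha> :: "'m set set ordinal option" where "krull_class R \<alpha> M"
    using krull_class_iff[OF rm] by blast
  then obtain \<gamma> :: "('a, 'm) module ordinal option" where "krull_class R \<gamma> M"
    using krull_class_any_wellorder by blast
  then have whole: "krull_interval ?L \<gamma> (carrier M) {\<zero>\<^bsub>M\<^esub>}"
    using krull_class_iff[OF rm] by blast
  have "{\<zero>\<^bsub>M\<^esub>} < carrier M" using nz by (auto simp: zero_module_def)
  with whole have "\<exists>\<alpha> :: ('a, 'm) module ordinal. \<exists>A \<in> ?L. {\<zero>\<^bsub>M\<^esub>} < A \<and> A \<subseteq> carrier M \<and>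
      (\<forall>B \<in> ?L. {\<zero>\<^bsub>M\<^esub>} < B \<and> B \<subseteq> A \<longrightarrow> critical_interval ?L \<alpha> B {\<zero>\<^bsub>M\<^esub>})"
    by (intro critical_interval_exists) (simp_all add: carrier_submodule)
  then obtain \<alpha> :: "('a, 'm) module ordinal" and A where
    A: "submodule A R M" "{\<zero>\<^bsub>M\<^esub>} < A" "A \<subseteq> carrier M"
    and crit: "\<forall>B \<in> ?L. {\<zero>\<^bsub>M\<^esub>} < B \<and> B \<subseteq> A \<longrightarrow> critical_interval ?L \<alpha> B {\<zero>\<^bsub>M\<^esub>}"
    by blast
  \<comment> \<open>Any nonzero x in A will do: criticality holds for all nonzero submodules of A,
    in particular for xR.\<close>
  obtain x where x: "x \<in> A" "x \<noteq> \<zero>\<^bsub>M\<^esub>" "x \<in> carrier M" using A by blast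
  define X where "X = (\<lambda>r. r \<odot>\<^bsub>M\<^esub> x) ` carrier R"
  note cyc = cyclic_epi[OF x(3), folded X_def]
  interpret X: right_module R "M\<lparr>carrier := X\<rparr>" by (rule submodule_right_module) fact
  interpret f: right_module_epi R "regular_module R" "M\<lparr>carrier := X\<rparr>" "\<lambda>r. r \<odot>\<^bsub>M\<^esub> x" by fact
  have "{\<zero>\<^bsub>M\<^esub>} < X" "X \<subseteq> A"
    using submodule_zero[OF cyc(1)] cyc(2) x A(1) submodule_smult[of A] by (auto simp: X_def)
  with crit cyc(1) have "critical_interval ?L \<alpha> X {\<zero>\<^bsub>M\<^esub>}" by blast
  then have "critical_interval (submodules R (M\<lparr>carrier := X\<rparr>)) \<alpha> X {\<zero>\<^bsub>M\<^esub>}"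
    using krull_interval_restrict[OF cyc(1) cyc(1)] zero_submodule \<open>{\<zero>\<^bsub>M\<^esub>} < X\<close>
    unfolding critical_interval_def by (auto simp: submodules_restrict[OF cyc(1)])
  then have "critical_of_dim R \<alpha> (M\<lparr>carrier := X\<rparr>)"
    unfolding X.critical_of_dim_iff by simp
  moreover have "rmod_iso R (M\<lparr>carrier := X\<rparr>) (quot_module (regular_module R) f.ker)"
    using rmod_iso_sym[OF f.first_isomorphism] f.M.quot_right_module[OF f.ker_submodule]
      X.right_module_axioms by blast
  ultimately have "critical_of_dim R \<alpha> (quot_module (regular_module R) (annihilator R M x))"
    using rmod_iso_critical_of_dim X.right_module_axioms
      f.M.quot_right_module[OF f.ker_submodule] cyc(4) by metis
  then show ?thesis using x by blast
qed

end

text \<open>For M on the type \<open>'a set\<close>, the ordinals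
  \<open>('a, 'a set) module ordinal\<close> found for M are those that
  \<open>critical_module\<close> prescribes for R/I.\<close>

lemma (in ring) cocritical_pa_set: "right_noetherian_pa_set R {I. cocritical I R}"
proof -
  have "\<exists>I. cocritical I R \<and> point_annihilator R M I"
    if M: "right_module R M" "noetherian_module R M" "\<not> zero_module M" for M :: "('a, 'a set) module"
  proof -
    interpret M: right_module R M by fact
    show ?thesis
      using M.noetherian_cocritical_annihilator[OF M(2,3)] M.annihilator_right_ideal
      unfolding cocritical_def critical_module_def point_annihilator_def by blast
  qed
  then show ?thesis by (auto simp: right_noetherian_pa_set_def cocritical_def)
qed

lemma (in ring) cocritical_closed_under_similarity:
  "closed_under_similarity R {I. cocritical I R}"
proof -
  interpret Rg: right_module R "regular_module R" by (rule regular_right_module)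
  have Q: "right_module R (quot_module (regular_module R) I)" if "right_ideal I R" for I
    using that Rg.quot_right_module submodule_regular_iff by blast
  have "cocritical J R" if "cocritical I R" "right_ideal J R" "similar R J I" for I J
    using that Q rmod_iso_sym rmod_iso_critical_of_dim
    unfolding cocritical_def critical_module_def similar_def by metis
  then show ?thesis by (auto simp: closed_under_similarity_def)
qed


section \<open>The Oka condition for principal right ideals\<close>

lemma rmod_iso_trans:
  assumes "rmod_iso R M N" "rmod_iso R N P"
  shows "rmod_iso R M P"
proof -
  obtain f where f: "bij_betw f (carrier M) (carrier N)"
    "\<forall>x \<in> carrier M. \<forall>y \<in> carrier M. f (x \<oplus>\<^bsub>M\<^esub> y) = f x \<oplus>\<^bsub>N\<^esub> f y"
    "\<forall>r \<in> carrier R. \<forall>x \<in> carrier M. f (r \<odot>\<^bsub>M\<^esub> x) = r \<odot>\<^bsub>N\<^esub> f x"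
    using assms(1) unfolding rmod_iso_def by blast
  obtain g where g: "bij_betw g (carrier N) (carrier P)"
    "\<forall>x \<in> carrier N. \<forall>y \<in> carrier N. g (x \<oplus>\<^bsub>N\<^esub> y) = g x \<oplus>\<^bsub>P\<^esub> g y"
    "\<forall>r \<in> carrier R. \<forall>x \<in> carrier N. g (r \<odot>\<^bsub>N\<^esub> x) = r \<odot>\<^bsub>P\<^esub> g x"
    using assms(2) unfolding rmod_iso_def by blast
  have "f x \<in> carrier N" if "x \<in> carrier M" for x using f(1) that by (rule bij_betw_apply)
  then show ?thesis
    unfolding rmod_iso_def using bij_betw_trans[OF f(1) g(1)] f(2,3) g(2,3)
    by (intro exI[of _ "g \<circ> f"]) simp
qed

section \<open>Similarity expressed by generators of R/I\<close>

context ring begin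

lemma regular_module_simps [simp]:
  "carrier (regular_module R) = carrier R" "zero (regular_module R) = \<zero>"
  "add (regular_module R) = add R" "r \<odot>\<^bsub>regular_module R\<^esub> x = x \<otimes> r"
  by (simp_all add: regular_module_def)

lemma regular_module_minus [simp]: "x \<ominus>\<^bsub>regular_module R\<^esub> y = x \<ominus> y"
proof -
  have "inv\<^bsub>add_monoid (regular_module R)\<^esub> y = inv\<^bsub>add_monoid R\<^esub> y"
    by (rule m_inv_cong) (simp_all only: regular_module_simps partial_object.simps monoid.simps)
  then show ?thesis by (simp add: a_minus_def a_inv_def)
qed

lemma right_ideal_iff: "right_ideal I R \<longleftrightarrow> I \<subseteq> carrier R \<and> \<zero> \<in> I \<and>
    (\<forall>x \<in> I. \<forall>y \<in> I. x \<oplus> y \<in> I) \<and> (\<forall>r \<in> carrier R. \<forall>x \<in> I. x \<otimes> r \<in> I)"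
proof -
  interpret Rg: right_module R "regular_module R" by (rule regular_right_module)
  show ?thesis unfolding submodule_regular_iff[symmetric] Rg.submodule_iff by simp
qed

lemma right_idealD:
  assumes "right_ideal I R"
  shows right_ideal_subset: "I \<subseteq> carrier R" and right_ideal_zero: "\<zero> \<in> I"
    and right_ideal_add: "\<lbrakk>x \<in> I; y \<in> I\<rbrakk> \<Longrightarrow> x \<oplus> y \<in> I"
    and right_ideal_mult: "\<lbrakk>x \<in> I; r \<in> carrier R\<rbrakk> \<Longrightarrow> x \<otimes> r \<in> I"
    and right_ideal_minus: "\<lbrakk>x \<in> I; y \<in> I\<rbrakk> \<Longrightarrow> x \<ominus> y \<in> I"
proof -
  interpret Rg: right_module R "regular_module R" by (rule regular_right_module)
  show "\<lbrakk>x \<in> I; y \<in> I\<rbrakk> \<Longrightarrow> x \<ominus> y \<in> I"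
    using assms Rg.submodule_minus_closed[of I x y] by (simp add: submodule_regular_iff)
qed (use assms in \<open>auto simp: right_ideal_iff\<close>)

lemma right_ideal_add_cancel:
  assumes "right_ideal I R" "x \<in> carrier R" "x \<ominus> y \<in> I" "y \<in> I"
  shows "x \<in> I"
proof -
  have "y \<in> carrier R" using assms right_ideal_subset by blast
  then have "x = (x \<ominus> y) \<oplus> y" using assms(2) by (simp add: a_minus_def a_assoc l_neg)
  then show ?thesis using assms right_ideal_add by metis
qed

text \<open>The witness \<open>b\<close> represents the image of the generator \<open>1 + J\<close> under an isomorphism
  \<open>R/J \<cong> R/I\<close>.\<close>

lemma similar_iff:
  assumes I: "right_ideal I R" and J: "right_ideal J R"
  shows "similar R J I \<longleftrightarrow> (\<exists>b \<in> carrier R. J = {r \<in> carrier R. b \<otimes> r \<in> I} \<and>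
    (\<forall>x \<in> carrier R. \<exists>r \<in> carrier R. x \<ominus> b \<otimes> r \<in> I))"
proof
  interpret Rg: right_module R "regular_module R" by (rule regular_right_module)
  let ?T = "regular_module R"
  have sI: "submodule I R ?T" and sJ: "submodule J R ?T"
    using I J by (simp_all add: submodule_regular_iff)
  note Q_carrier = A_RCOSETS_def'[of ?T]
  have eqI: "I +>\<^bsub>?T\<^esub> x = I +>\<^bsub>?T\<^esub> y \<longleftrightarrow> x \<ominus> y \<in> I" if "x \<in> carrier R" "y \<in> carrier R" for x y
    using Rg.quot_coset_eq_iff[OF sI] that by simp
  interpret QI: right_module R "quot_module ?T I" by (rule Rg.quot_right_module[OF sI])
  interpret QJ: right_module R "quot_module ?T J" by (rule Rg.quot_right_module[OF sJ])
  interpret eI: right_module_epi R ?T "quot_module ?T I" "\<lambda>x. I +>\<^bsub>?T\<^esub> x"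
    by (rule Rg.quot_epi(1)[OF sI])
  interpret eJ: right_module_epi R ?T "quot_module ?T J" "\<lambda>x. J +>\<^bsub>?T\<^esub> x"
    by (rule Rg.quot_epi(1)[OF sJ])
  have zero_iff: "I +>\<^bsub>?T\<^esub> x = I \<longleftrightarrow> x \<in> I" if "x \<in> carrier R" for x
    using Rg.quot_epi(2)[OF sI] that unfolding eI.ker_def by auto
  have zero_iff_J: "J +>\<^bsub>?T\<^esub> x = J \<longleftrightarrow> x \<in> J" if "x \<in> carrier R" for x
    using Rg.quot_epi(2)[OF sJ] that unfolding eJ.ker_def by auto
  {
    assume "similar R J I"
    then obtain \<phi> where \<phi>: "right_module_epi R (quot_module ?T J) (quot_module ?T I) \<phi>"
      and inj: "inj_on \<phi> (carrier (quot_module ?T J))"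
      unfolding similar_def by (rule rmod_iso_epi[OF _ QJ.right_module_axioms QI.right_module_axioms])
    interpret \<phi>: right_module_epi R "quot_module ?T J" "quot_module ?T I" \<phi> by fact
    have "\<phi> (J +>\<^bsub>?T\<^esub> \<one>) \<in> carrier (quot_module ?T I)"
      using eJ.hom_closed[of \<one>] by (intro \<phi>.hom_closed) simp
    then obtain b where b: "b \<in> carrier R" "\<phi> (J +>\<^bsub>?T\<^esub> \<one>) = I +>\<^bsub>?T\<^esub> b"
      by (auto simp: Q_carrier)
    have img: "\<phi> (J +>\<^bsub>?T\<^esub> r) = I +>\<^bsub>?T\<^esub> (b \<otimes> r)" if r: "r \<in> carrier R" for r
      using \<phi>.hom_smult[OF r, of "J +>\<^bsub>?T\<^esub> \<one>"] Rg.quot_smult_coset[OF sJ r, of \<one>]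
        Rg.quot_smult_coset[OF sI r, of b] eJ.hom_closed[of \<one>] b r by simp
    have "r \<in> J \<longleftrightarrow> b \<otimes> r \<in> I" if r: "r \<in> carrier R" for r
    proof -
      have "r \<in> J \<longleftrightarrow> J +>\<^bsub>?T\<^esub> r = \<zero>\<^bsub>quot_module ?T J\<^esub>" using zero_iff_J r by simp
      also have "\<dots> \<longleftrightarrow> \<phi> (J +>\<^bsub>?T\<^esub> r) = \<phi> \<zero>\<^bsub>quot_module ?T J\<^esub>"
        using inj_on_eq_iff[OF inj] eJ.hom_closed[of r] QJ.M.zero_closed r by auto
      also have "\<dots> \<longleftrightarrow> b \<otimes> r \<in> I"
        using \<phi>.hom_zero zero_iff[of "b \<otimes> r"] img[OF r] b(1) r by simp
      finally show ?thesis .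
    qed
    then have "J = {r \<in> carrier R. b \<otimes> r \<in> I}" using right_ideal_subset[OF J] by blast
    moreover have "\<exists>r \<in> carrier R. x \<ominus> b \<otimes> r \<in> I" if x: "x \<in> carrier R" for x
    proof -
      have "I +>\<^bsub>?T\<^esub> x \<in> \<phi> ` carrier (quot_module ?T J)"
        using \<phi>.surj eI.hom_closed[of x] x by simp
      then obtain r where "r \<in> carrier R" "I +>\<^bsub>?T\<^esub> x = \<phi> (J +>\<^bsub>?T\<^esub> r)"
        by (auto simp: Q_carrier)
      then show ?thesis using img eqI x b(1) by auto
    qed
    ultimately show "\<exists>b \<in> carrier R. J = {r \<in> carrier R. b \<otimes> r \<in> I} \<and>
      (\<forall>x \<in> carrier R. \<exists>r \<in> carrier R. x \<ominus> b \<otimes> r \<in> I)" using b(1) by blast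
  next
    assume "\<exists>b \<in> carrier R. J = {r \<in> carrier R. b \<otimes> r \<in> I} \<and>
      (\<forall>x \<in> carrier R. \<exists>r \<in> carrier R. x \<ominus> b \<otimes> r \<in> I)"
    then obtain b where b: "b \<in> carrier R" "J = {r \<in> carrier R. b \<otimes> r \<in> I}"
      "\<And>x. x \<in> carrier R \<Longrightarrow> \<exists>r \<in> carrier R. x \<ominus> b \<otimes> r \<in> I" by blast
    have bQ: "I +>\<^bsub>?T\<^esub> b \<in> carrier (quot_module ?T I)" using eI.hom_closed[of b] b(1) by simp
    have sm: "r \<odot>\<^bsub>quot_module ?T I\<^esub> (I +>\<^bsub>?T\<^esub> b) = I +>\<^bsub>?T\<^esub> (b \<otimes> r)" if "r \<in> carrier R" for r
      using Rg.quot_smult_coset[OF sI that, of b] b(1) by simp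
    \<comment> \<open>The coset of b generates R/I by \<open>b(3)\<close> and has annihilator J, so
      R/J \<cong> R/I comes from the first isomorphism theorem.\<close>
    define X where "X = (\<lambda>r. r \<odot>\<^bsub>quot_module ?T I\<^esub> (I +>\<^bsub>?T\<^esub> b)) ` carrier R"
    note cyc = QI.cyclic_epi[OF bQ, folded X_def]
    have "carrier (quot_module ?T I) \<subseteq> X"
    proof
      fix Y assume "Y \<in> carrier (quot_module ?T I)"
      then obtain x where x: "x \<in> carrier R" "Y = I +>\<^bsub>?T\<^esub> x" by (auto simp: Q_carrier)
      then obtain r where r: "r \<in> carrier R" "x \<ominus> b \<otimes> r \<in> I" using b(3) by blast
      then have "Y = r \<odot>\<^bsub>quot_module ?T I\<^esub> (I +>\<^bsub>?T\<^esub> b)"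
        using x sm eqI[of x "b \<otimes> r"] b(1) by simp
      then show "Y \<in> X" using r by (auto simp: X_def)
    qed
    then have X: "X = carrier (quot_module ?T I)" using QI.submodule_subset[OF cyc(1)] by blast
    \<comment> \<open>\<open>cyclic_epi\<close> maps onto a submodule, written as a record with
      changed carrier; here that submodule is the whole quotient.\<close>
    have same: "(quot_module ?T I)\<lparr>carrier := X\<rparr> = quot_module ?T I"
      unfolding X by (rule module.equality) simp_all
    have "r \<odot>\<^bsub>quot_module ?T I\<^esub> (I +>\<^bsub>?T\<^esub> b) = \<zero>\<^bsub>quot_module ?T I\<^esub> \<longleftrightarrow> b \<otimes> r \<in> I"
      if "r \<in> carrier R" for r
      using sm[OF that] zero_iff[of "b \<otimes> r"] b(1) that by simp
    then have ann: "annihilator R (quot_module ?T I) (I +>\<^bsub>?T\<^esub> b) = J"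
      unfolding annihilator_def b(2) by blast
    show "similar R J I"
      using right_module_epi.first_isomorphism[OF cyc(3)] cyc(4)
      unfolding similar_def same ann by simp
  }
qed

lemma similar_refl: "right_ideal I R \<Longrightarrow> similar R I I"
  unfolding similar_def rmod_iso_def by (intro exI[of _ id]) auto

lemma similar_trans: "similar R I J \<Longrightarrow> similar R J K \<Longrightarrow> similar R I K"
  unfolding similar_def by (rule rmod_iso_trans)

lemma principal_right_ideal_iff:
  "principal_right_ideal I R \<longleftrightarrow> (\<exists>x \<in> carrier R. I = (\<lambda>r. x \<otimes> r) ` carrier R)"
  by (auto simp: principal_right_ideal_def l_coset_def)

section \<open>Congruence modulo a right ideal, \<open>adjoin\<close> and
  \<open>colon\<close>\<close>

lemma cong_right_ideal_iff:
  assumes I: "right_ideal I R" and c: "x \<in> carrier R" "y \<in> carrier R" "z \<in> carrier R"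
    and yz: "y \<ominus> z \<in> I"
  shows "x \<ominus> y \<in> I \<longleftrightarrow> x \<ominus> z \<in> I"
proof -
  have 1: "x \<ominus> z = (x \<ominus> y) \<oplus> (y \<ominus> z)"
    using c by (simp add: a_minus_def a_ac r_neg1 r_neg2)
  have 2: "x \<ominus> y = (x \<ominus> z) \<ominus> (y \<ominus> z)"
    using c by (simp add: a_minus_def minus_add a_assoc a_comm[of "\<ominus> y" z] r_neg1)
  show ?thesis
  proof
    assume "x \<ominus> y \<in> I"
    then show "x \<ominus> z \<in> I" unfolding 1 using yz by (rule right_ideal_add[OF I])
  next
    assume "x \<ominus> z \<in> I"
    then show "x \<ominus> y \<in> I" unfolding 2 using yz by (rule right_ideal_minus[OF I])
  qed
qed

lemma mem_right_ideal_cong: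
  assumes I: "right_ideal I R" and c: "x \<in> carrier R" "y \<in> carrier R" and "x \<ominus> y \<in> I"
  shows "x \<in> I \<longleftrightarrow> y \<in> I"
proof -
  have "x \<ominus> (x \<ominus> y) = x \<oplus> (\<ominus> x \<oplus> y)" using c by (simp add: a_minus_def minus_add)
  then have y: "x \<ominus> (x \<ominus> y) = y" using c by (simp only: r_neg2)
  show ?thesis
  proof
    assume "x \<in> I"
    then show "y \<in> I" using right_ideal_minus[OF I _ assms(4), of x] unfolding y by blast
  qed (rule right_ideal_add_cancel[OF I c(1) assms(4)])
qed

text \<open>This is I + aR. Writing it by congruence modulo I makes its preimages under left
  multiplication easy to compute.\<close>

definition adjoin :: "'a set \<Rightarrow> 'a \<Rightarrow> 'a set" where
  "adjoin I a = {y \<in> carrier R. \<exists>s \<in> carrier R. y \<ominus> a \<otimes> s \<in> I}"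

text \<open>The annihilator of the coset of a in R/I.\<close>

definition colon :: "'a set \<Rightarrow> 'a \<Rightarrow> 'a set" where
  "colon I a = {r \<in> carrier R. a \<otimes> r \<in> I}"

lemma adjoin_right_ideal:
  assumes I: "right_ideal I R" and a: "a \<in> carrier R"
  shows "right_ideal (adjoin I a) R" "I \<subseteq> adjoin I a" "a \<in> adjoin I a"
proof -
  have sub: "I \<subseteq> carrier R" using I by (rule right_ideal_subset)
  have minus0: "x \<ominus> a \<otimes> \<zero> = x" if "x \<in> carrier R" for x
    using that a by (simp add: a_minus_def)
  show I_sub: "I \<subseteq> adjoin I a"
  proof
    fix x assume "x \<in> I"
    then have "x \<in> carrier R" "x \<ominus> a \<otimes> \<zero> \<in> I" using sub minus0[of x] by auto
    then show "x \<in> adjoin I a" unfolding adjoin_def by blast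
  qed
  have "a \<ominus> a \<otimes> \<one> = \<zero>" using a by (simp add: a_minus_def r_neg)
  then show "a \<in> adjoin I a"
    using a right_ideal_zero[OF I] by (auto simp: adjoin_def intro!: bexI[of _ \<one>])
  show "right_ideal (adjoin I a) R"
    unfolding right_ideal_iff
  proof (intro conjI ballI)
    show "adjoin I a \<subseteq> carrier R" by (auto simp: adjoin_def)
    show "\<zero> \<in> adjoin I a" using I_sub right_ideal_zero[OF I] by blast
  next
    fix x y assume "x \<in> adjoin I a" "y \<in> adjoin I a"
    then obtain s t where st: "x \<in> carrier R" "y \<in> carrier R" "s \<in> carrier R" "t \<in> carrier R"
      "x \<ominus> a \<otimes> s \<in> I" "y \<ominus> a \<otimes> t \<in> I" by (auto simp: adjoin_def)
    have "(x \<oplus> y) \<ominus> a \<otimes> (s \<oplus> t) = (x \<ominus> a \<otimes> s) \<oplus> (y \<ominus> a \<otimes> t)"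
      using st(1-4) a by algebra
    then have "(x \<oplus> y) \<ominus> a \<otimes> (s \<oplus> t) \<in> I" using right_ideal_add[OF I st(5,6)] by simp
    then show "x \<oplus> y \<in> adjoin I a" using st(1-4) unfolding adjoin_def by blast
  next
    fix r x assume r: "r \<in> carrier R" and "x \<in> adjoin I a"
    then obtain s where s: "x \<in> carrier R" "s \<in> carrier R" "x \<ominus> a \<otimes> s \<in> I"
      by (auto simp: adjoin_def)
    have "x \<otimes> r \<ominus> a \<otimes> (s \<otimes> r) = (x \<ominus> a \<otimes> s) \<otimes> r"
      using s(1,2) r a by algebra
    then have "x \<otimes> r \<ominus> a \<otimes> (s \<otimes> r) \<in> I" using right_ideal_mult[OF I s(3) r] by simp
    then show "x \<otimes> r \<in> adjoin I a" using s r unfolding adjoin_def by blast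
  qed
qed

lemma colon_right_ideal:
  assumes I: "right_ideal I R" and a: "a \<in> carrier R"
  shows "right_ideal (colon I a) R"
  unfolding right_ideal_iff colon_def
  using a right_ideal_zero[OF I] right_ideal_add[OF I] right_ideal_mult[OF I]
  by (auto simp: r_distr m_assoc[symmetric])

text \<open>By \<open>gen\<close> the coset of b generates R/I, and its annihilator is
  \<open>colon I b\<close>.\<close>

lemma similar_colonI:
  assumes I: "right_ideal I R" and b: "b \<in> carrier R"
    and gen: "\<And>x. x \<in> carrier R \<Longrightarrow> \<exists>r \<in> carrier R. x \<ominus> b \<otimes> r \<in> I"
  shows "similar R (colon I b) I"
  unfolding similar_iff[OF I colon_right_ideal[OF I b]]
  using b gen by (intro bexI[of _ b]) (auto simp: colon_def)

section \<open>The family \<open>F_pr_circ\<close>\<close>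

lemma F_pr_circD: "I \<in> F_pr_circ R \<Longrightarrow> right_ideal I R" "I \<in> F_pr_circ R \<Longrightarrow> principal_right_ideal I R"
  using similar_refl by (auto simp: F_pr_circ_def)

lemma F_pr_circ_similar:
  assumes "I \<in> F_pr_circ R" "right_ideal J R" "similar R J I"
  shows "J \<in> F_pr_circ R"
  using assms similar_trans unfolding F_pr_circ_def by blast

text \<open>The quotient of R by itself is zero, so R is similar only to itself. A right ideal
  outside the family is therefore proper.\<close>

lemma carrier_F_pr_circ: "carrier R \<in> F_pr_circ R"
proof -
  have "carrier R = (\<lambda>r. \<one> \<otimes> r) ` carrier R" by simp
  then have princ: "principal_right_ideal (carrier R) R"
    unfolding principal_right_ideal_iff using one_closed by blast
  have R: "right_ideal (carrier R) R" by (simp add: right_ideal_iff)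
  have "J = carrier R" if "right_ideal J R" "similar R J (carrier R)" for J
    using that similar_iff[OF R that(1)] by auto
  then show ?thesis using R princ by (auto simp: F_pr_circ_def)
qed

text \<open>An isomorphism \<open>R/I \<cong> R/J\<close> carries the data of \<open>I\<close> to \<open>J\<close>, so it is enough to see that \<open>I\<close> itself
  is principal: if \<open>I + aR = cR\<close> then \<open>I = c (c\<^sup>-\<^sup>1 I)\<close>, and \<open>c\<^sup>-\<^sup>1 I\<close> is similar to \<open>a\<^sup>-\<^sup>1 I\<close> because both
  are point annihilators of generators of the cyclic module \<open>(I + aR)/I\<close>.\<close>

lemma principal_if_adjoin_colon:
  assumes I: "right_ideal I R" and a: "a \<in> carrier R"
    and adj: "principal_right_ideal (adjoin I a) R" and col: "colon I a \<in> F_pr_circ R"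
  shows "principal_right_ideal I R"
proof -
  obtain c where c: "c \<in> carrier R" "adjoin I a = (\<lambda>r. c \<otimes> r) ` carrier R"
    using adj principal_right_ideal_iff by blast
  \<comment> \<open>As c lies in I + aR and a lies in cR, there are t with c congruent to a t modulo
    I and s with a = c s.\<close>
  have "c \<in> adjoin I a" unfolding c(2) using c(1) by (auto intro!: image_eqI[of _ _ \<one>])
  then obtain t where t: "t \<in> carrier R" "c \<ominus> a \<otimes> t \<in> I" by (auto simp: adjoin_def)
  obtain s where s: "s \<in> carrier R" "a = c \<otimes> s"
    using adjoin_right_ideal(3)[OF I a] c(2) by auto
  have cat: "c \<otimes> r \<ominus> (a \<otimes> t) \<otimes> r \<in> I" if r: "r \<in> carrier R" for r
  proof -
    have "c \<otimes> r \<ominus> (a \<otimes> t) \<otimes> r = (c \<ominus> a \<otimes> t) \<otimes> r" using c(1) a t(1) r by algebra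
    then show ?thesis using right_ideal_mult[OF I t(2) r] by simp
  qed
  have "colon (colon I a) t = colon I c"
  proof -
    have "a \<otimes> (t \<otimes> r) \<in> I \<longleftrightarrow> c \<otimes> r \<in> I" if r: "r \<in> carrier R" for r
      using mem_right_ideal_cong[OF I _ _ cat[OF r]] a c(1) t(1) r by (simp add: m_assoc)
    then show ?thesis using t(1) by (auto simp: colon_def)
  qed
  \<comment> \<open>The coset of t generates R modulo \<open>colon I a\<close>: for r = s x one gets
    a (x - t s x) = c s x - a t s x, which is in I by \<open>cat\<close>.\<close>
  moreover have "\<exists>r \<in> carrier R. x \<ominus> t \<otimes> r \<in> colon I a" if x: "x \<in> carrier R" for x
  proof
    show sx: "s \<otimes> x \<in> carrier R" using s x by simp
    have "a \<otimes> (x \<ominus> t \<otimes> (s \<otimes> x)) = c \<otimes> (s \<otimes> x) \<ominus> (a \<otimes> t) \<otimes> (s \<otimes> x)"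
    proof -
      have "a \<otimes> (x \<ominus> t \<otimes> (s \<otimes> x)) = a \<otimes> x \<ominus> (a \<otimes> t) \<otimes> (s \<otimes> x)"
        using a x t(1) s(1) by algebra
      also have "a \<otimes> x = c \<otimes> (s \<otimes> x)" using s c(1) x by (simp add: m_assoc)
      finally show ?thesis .
    qed
    then show "x \<ominus> t \<otimes> (s \<otimes> x) \<in> colon I a"
      using cat[OF sx] x t(1) sx by (simp add: colon_def)
  qed
  ultimately have sim: "similar R (colon I c) (colon I a)"
    using similar_colonI[OF colon_right_ideal[OF I a] t(1)] by simp
  then have "principal_right_ideal (colon I c) R"
    using F_pr_circ_similar[OF col colon_right_ideal[OF I c(1)]] F_pr_circD(2) by blast
  then obtain e where e: "e \<in> carrier R" "colon I c = (\<lambda>r. e \<otimes> r) ` carrier R"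
    using principal_right_ideal_iff by blast
  \<comment> \<open>Each x in I lies in cR, so x = c y with y in \<open>colon I c\<close>, and this
    right ideal is generated by e.\<close>
  have "I = (\<lambda>r. (c \<otimes> e) \<otimes> r) ` carrier R"
  proof
    show "I \<subseteq> (\<lambda>r. (c \<otimes> e) \<otimes> r) ` carrier R"
    proof
      fix x assume x: "x \<in> I"
      then obtain y where y: "y \<in> carrier R" "x = c \<otimes> y"
        using adjoin_right_ideal(2)[OF I a] c(2) by auto
      then have "y \<in> colon I c" using x by (simp add: colon_def)
      then obtain z where "z \<in> carrier R" "y = e \<otimes> z" using e(2) by auto
      then show "x \<in> (\<lambda>r. (c \<otimes> e) \<otimes> r) ` carrier R"
        using y c(1) e(1) by (auto simp: m_assoc)
    qed
    have "c \<otimes> (e \<otimes> r) \<in> I" if "r \<in> carrier R" for r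
      using e(2) that unfolding colon_def by blast
    then show "(\<lambda>r. (c \<otimes> e) \<otimes> r) ` carrier R \<subseteq> I"
      using c(1) e(1) by (auto simp: m_assoc)
  qed
  then show ?thesis unfolding principal_right_ideal_iff using c(1) e(1) by blast
qed

text \<open>Let J be similar to I through b, and choose a' with b a' congruent to a modulo I. Then J
  and a' have the same colon as I and a, and \<open>adjoin J a'\<close> is similar to
  \<open>adjoin I a\<close>; so \<open>principal_if_adjoin_colon\<close> applies to J.\<close>

lemma F_pr_circ_Oka:
  assumes I: "right_ideal I R" and a: "a \<in> carrier R"
    and adj: "adjoin I a \<in> F_pr_circ R" and col: "colon I a \<in> F_pr_circ R"
  shows "I \<in> F_pr_circ R"
proof -
  have "principal_right_ideal J R" if J: "right_ideal J R" and "similar R J I" for J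
  proof -
    obtain b where b: "b \<in> carrier R" "J = {r \<in> carrier R. b \<otimes> r \<in> I}"
      and gen: "\<And>x. x \<in> carrier R \<Longrightarrow> \<exists>r \<in> carrier R. x \<ominus> b \<otimes> r \<in> I"
      using \<open>similar R J I\<close> similar_iff[OF I J] by blast
    obtain a' where a': "a' \<in> carrier R" "a \<ominus> b \<otimes> a' \<in> I" using gen[OF a] by blast
    have aba: "a \<otimes> r \<ominus> (b \<otimes> a') \<otimes> r \<in> I" if r: "r \<in> carrier R" for r
    proof -
      have "a \<otimes> r \<ominus> (b \<otimes> a') \<otimes> r = (a \<ominus> b \<otimes> a') \<otimes> r" using a b(1) a'(1) r by algebra
      then show ?thesis using right_ideal_mult[OF I a'(2) r] by simp
    qed
    have "a' \<otimes> r \<in> J \<longleftrightarrow> a \<otimes> r \<in> I" if r: "r \<in> carrier R" for r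
      using mem_right_ideal_cong[OF I _ _ aba[OF r]] a b a'(1) r by (simp add: m_assoc)
    then have col': "colon J a' = colon I a" by (auto simp: colon_def)
    \<comment> \<open>Left multiplication by b turns congruence modulo J into congruence modulo I
      and takes a' to a.\<close>
    have "r \<ominus> a' \<otimes> s \<in> J \<longleftrightarrow> b \<otimes> r \<ominus> a \<otimes> s \<in> I" if "r \<in> carrier R" "s \<in> carrier R" for r s
    proof -
      have "b \<otimes> (r \<ominus> a' \<otimes> s) = b \<otimes> r \<ominus> (b \<otimes> a') \<otimes> s" using b(1) a'(1) that by algebra
      then have "r \<ominus> a' \<otimes> s \<in> J \<longleftrightarrow> b \<otimes> r \<ominus> (b \<otimes> a') \<otimes> s \<in> I"
        unfolding b(2) using a'(1) that by simp
      also have "\<dots> \<longleftrightarrow> b \<otimes> r \<ominus> a \<otimes> s \<in> I"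
        using cong_right_ideal_iff[OF I _ _ _ aba[OF that(2)], of "b \<otimes> r"] a a'(1) b(1) that by simp
      finally show ?thesis .
    qed
    then have adj': "adjoin J a' = colon (adjoin I a) b"
      using b(1) by (auto simp: adjoin_def colon_def)
    \<comment> \<open>The element b generates R modulo I, hence also modulo the larger right ideal I
      + aR.\<close>
    have "similar R (adjoin J a') (adjoin I a)"
      unfolding adj' using gen adjoin_right_ideal(1,2)[OF I a] b(1)
      by (intro similar_colonI) blast+
    then have "principal_right_ideal (adjoin J a') R"
      using adj adjoin_right_ideal(1)[OF J a'(1)] by (auto simp: F_pr_circ_def)
    then show ?thesis
      using principal_if_adjoin_colon[OF J a'(1)] col col' by simp
  qed
  then show ?thesis using I by (simp add: F_pr_circ_def)
qed

section \<open>Right ideals maximal outside \<open>F_pr_circ\<close>\<close>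

lemma Union_chain_right_ideal:
  assumes "C \<noteq> {}" "\<And>I. I \<in> C \<Longrightarrow> right_ideal I R"
    and "\<And>I J. I \<in> C \<Longrightarrow> J \<in> C \<Longrightarrow> I \<subseteq> J \<or> J \<subseteq> I"
  shows "right_ideal (\<Union>C) R"
  unfolding right_ideal_iff
proof (intro conjI ballI)
  show "\<Union>C \<subseteq> carrier R" using assms(2) right_ideal_subset by blast
  show "\<zero> \<in> \<Union>C" using assms(1,2) right_ideal_zero by blast
next
  fix x y assume "x \<in> \<Union>C" "y \<in> \<Union>C"
  then obtain I J where IJ: "I \<in> C" "J \<in> C" "x \<in> I" "y \<in> J" by blast
  then show "x \<oplus> y \<in> \<Union>C"
    using assms(3)[OF IJ(1,2)] right_ideal_add[OF assms(2)[OF IJ(1)]]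
      right_ideal_add[OF assms(2)[OF IJ(2)]] by blast
next
  fix r x assume "r \<in> carrier R" "x \<in> \<Union>C"
  then show "x \<otimes> r \<in> \<Union>C" using right_ideal_mult[OF assms(2)] by blast
qed

text \<open>A generator of the union lies in one member, which then contains the whole
  union.\<close>

lemma Union_chain_principal:
  assumes "C \<noteq> {}" "\<And>I. I \<in> C \<Longrightarrow> right_ideal I R"
    and "principal_right_ideal (\<Union>C) R"
  shows "\<Union>C \<in> C"
proof -
  obtain x where x: "x \<in> carrier R" "\<Union>C = (\<lambda>r. x \<otimes> r) ` carrier R"
    using assms(3) principal_right_ideal_iff by blast
  have "x \<in> \<Union>C" unfolding x(2) using x(1) by (auto intro!: image_eqI[of _ _ \<one>])
  then obtain I where I: "I \<in> C" "x \<in> I" by blast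
  then have "(\<lambda>r. x \<otimes> r) ` carrier R \<subseteq> I" using right_ideal_mult[OF assms(2)[OF I(1)] I(2)] by auto
  then have "\<Union>C = I" using I(1) x(2) by blast
  then show ?thesis using I by simp
qed

lemma quot_noetherian:
  assumes I: "right_ideal I R"
    and princ: "\<And>K. right_ideal K R \<Longrightarrow> I < K \<Longrightarrow> principal_right_ideal K R"
  shows "noetherian_module R (quot_module (regular_module R) I)"
  unfolding noetherian_module_def
proof (intro allI impI, elim conjE)
  interpret Rg: right_module R "regular_module R" by (rule regular_right_module)
  let ?T = "regular_module R" let ?Q = "quot_module ?T I"
  have sI: "submodule I R ?T" using I by (simp add: submodule_regular_iff)
  interpret e: right_module_epi R ?T ?Q "\<lambda>x. I +>\<^bsub>?T\<^esub> x" by (rule Rg.quot_epi(1)[OF sI])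
  fix C assume C: "\<forall>i :: nat. submodule (C i) R ?Q" and mono: "\<forall>i. C i \<subseteq> C (Suc i)"
  define D where "D i = {x \<in> carrier R. I +>\<^bsub>?T\<^esub> x \<in> C i}" for i
  have D: "right_ideal (D i) R" for i
    using e.vimage_submodule[of "C i"] C by (simp add: D_def submodule_regular_iff)
  have C_eq: "C i = (\<lambda>x. I +>\<^bsub>?T\<^esub> x) ` D i" for i
    using e.image_vimage[of "C i"] e.N.submodule_subset[of "C i"] C by (simp add: D_def)
  have I_sub: "I \<subseteq> D i" for i
  proof
    fix x assume x: "x \<in> I"
    then have "I +>\<^bsub>?T\<^esub> x = \<zero>\<^bsub>?Q\<^esub>" using Rg.quot_epi(2)[OF sI] unfolding e.ker_def by auto
    then show "x \<in> D i"
      using x right_ideal_subset[OF I] e.N.submodule_zero[of "C i"] C by (auto simp: D_def)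
  qed
  have D_mono: "D i \<subseteq> D j" if "i \<le> j" for i j
    using lift_Suc_mono_le[of C, OF _ that] mono by (auto simp: D_def)
  show "\<exists>n. \<forall>i\<ge>n. C i = C n"
  \<comment> \<open>Principality is assumed only strictly above I. Once some \<open>D i\<close>
    exceeds I, the union of all is principal and hence equal to one of them.\<close>
  proof (cases "\<forall>i. D i = I")
    case True
    then show ?thesis using C_eq by auto
  next
    case False
    then have "I < \<Union>(range D)" using I_sub by blast
    moreover have "right_ideal (\<Union>(range D)) R"
      using D D_mono nat_le_linear by (intro Union_chain_right_ideal) blast+
    ultimately have "\<Union>(range D) \<in> range D"
      using D princ by (intro Union_chain_principal) auto
    then obtain n where "\<Union>(range D) = D n" by blast
    then have "D i = D n" if "n \<le> i" for i using D_mono[OF that] by blast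
    then show ?thesis using C_eq by metis
  qed
qed

lemma principal_right_ideal_ring_if_pa_set:
  assumes pa: "right_noetherian_pa_set R S" and S: "S \<subseteq> F_pr_circ R"
  shows "principal_right_ideal_ring R"
proof (rule ccontr)
  assume "\<not> ?thesis"
  then obtain I0 where "right_ideal I0 R" "I0 \<notin> F_pr_circ R"
    using F_pr_circD ring_axioms unfolding principal_right_ideal_ring_def by blast
  then have "{I. right_ideal I R \<and> I \<notin> F_pr_circ R} \<noteq> {}" by blast
  moreover have "\<Union>C \<in> {I. right_ideal I R \<and> I \<notin> F_pr_circ R}"
    if C: "C \<noteq> {}" "subset.chain {I. right_ideal I R \<and> I \<notin> F_pr_circ R} C" for C
  proof -
    have "right_ideal I R" "I \<notin> F_pr_circ R" if "I \<in> C" for I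
      using C(2) that by (auto simp: subset_chain_def)
    moreover have "right_ideal (\<Union>C) R"
      using C calculation by (intro Union_chain_right_ideal) (auto simp: subset_chain_def)
    \<comment> \<open>If the union belonged to the family it would be principal, hence a member of
      the chain, but all members lie outside.\<close>
    ultimately show ?thesis using Union_chain_principal[of C] C(1) F_pr_circD(2) by blast
  qed
  ultimately obtain I where I: "right_ideal I R" "I \<notin> F_pr_circ R"
    and max: "\<And>K. right_ideal K R \<Longrightarrow> I < K \<Longrightarrow> K \<in> F_pr_circ R"
    using subset_Zorn_nonempty[of "{I. right_ideal I R \<and> I \<notin> F_pr_circ R}"] by blast
  interpret Rg: right_module R "regular_module R" by (rule regular_right_module)
  let ?T = "regular_module R" let ?Q = "quot_module ?T I"
  have sI: "submodule I R ?T" using I by (simp add: submodule_regular_iff)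
  interpret e: right_module_epi R ?T ?Q "\<lambda>x. I +>\<^bsub>?T\<^esub> x" by (rule Rg.quot_epi(1)[OF sI])
  have zero_iff: "I +>\<^bsub>?T\<^esub> x = \<zero>\<^bsub>?Q\<^esub> \<longleftrightarrow> x \<in> I" if "x \<in> carrier R" for x
    using Rg.quot_epi(2)[OF sI] that unfolding e.ker_def by auto
  have "noetherian_module R ?Q"
    using quot_noetherian[OF I(1)] max F_pr_circD(2) by blast
  moreover have "\<not> zero_module ?Q"
  proof
    assume "zero_module ?Q"
    then have "x \<in> I" if "x \<in> carrier R" for x
      using e.hom_closed[of x] zero_iff[OF that] that unfolding zero_module_def by simp
    then have "I = carrier R" using right_ideal_subset[OF I(1)] by blast
    then show False using I(2) carrier_F_pr_circ by simp
  qed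
  ultimately obtain J where J: "J \<in> S" "point_annihilator R ?Q J"
    using pa e.N.right_module_axioms unfolding right_noetherian_pa_set_def by blast
  then obtain X where X: "X \<in> carrier ?Q" "X \<noteq> \<zero>\<^bsub>?Q\<^esub>" "J = annihilator R ?Q X"
    unfolding point_annihilator_def by blast
  obtain a where a: "a \<in> carrier R" "X = I +>\<^bsub>?T\<^esub> a"
    using X(1) by (auto simp: A_RCOSETS_def'[of ?T])
  then have "a \<notin> I" using X(2) zero_iff by blast
  have "r \<odot>\<^bsub>?Q\<^esub> X = \<zero>\<^bsub>?Q\<^esub> \<longleftrightarrow> a \<otimes> r \<in> I" if "r \<in> carrier R" for r
    using Rg.quot_smult_coset[OF sI that, of a] zero_iff[of "a \<otimes> r"] a that by simp
  then have "J = colon I a" unfolding X(3) annihilator_def colon_def by blast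
  moreover have "adjoin I a \<in> F_pr_circ R"
    \<comment> \<open>Since a is not in I, the right ideal I + aR is strictly larger than I.\<close>
    using adjoin_right_ideal[OF I(1) a(1)] \<open>a \<notin> I\<close> by (intro max) auto
  ultimately have "I \<in> F_pr_circ R" using F_pr_circ_Oka[OF I(1) a(1)] J(1) S by blast
  then show False using I(2) by simp
qed

end

theorem theorem5p11:
  fixes R :: "('a, 'r) ring_scheme"
  assumes "ring R"
  shows "(\<forall>S. right_noetherian_pa_set R S \<and> closed_under_similarity R S \<longrightarrow>
            (principal_right_ideal_ring R \<longleftrightarrow> (\<forall>I \<in> S. principal_right_ideal I R)) \<and>
            ((\<forall>I \<in> S. principal_right_ideal I R) \<longleftrightarrow> right_noetherian_pa_set R (F_pr_circ R)))
       \<and> (principal_right_ideal_ring R \<longleftrightarrow>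
            (\<forall>I. cocritical I R \<longrightarrow> principal_right_ideal I R))"
proof -
  interpret ring R by fact
  have equiv: "(principal_right_ideal_ring R \<longleftrightarrow> (\<forall>I \<in> S. principal_right_ideal I R)) \<and>
      ((\<forall>I \<in> S. principal_right_ideal I R) \<longleftrightarrow> right_noetherian_pa_set R (F_pr_circ R))"
    if S: "right_noetherian_pa_set R S" "closed_under_similarity R S" for S
  proof -
    have 1: "\<forall>I \<in> S. principal_right_ideal I R" if "principal_right_ideal_ring R"
      using that S(1) unfolding principal_right_ideal_ring_def right_noetherian_pa_set_def by blast
    have 2: "right_noetherian_pa_set R (F_pr_circ R)" if "\<forall>I \<in> S. principal_right_ideal I R"
    proof -
      \<comment> \<open>A right ideal similar to a member of S is in S again, and so is
        principal.\<close>
      have "S \<subseteq> F_pr_circ R"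
        using that S unfolding F_pr_circ_def closed_under_similarity_def right_noetherian_pa_set_def
        by blast
      then show ?thesis
        using S(1) F_pr_circD(1) unfolding right_noetherian_pa_set_def by blast
    qed
    have 3: "principal_right_ideal_ring R" if "right_noetherian_pa_set R (F_pr_circ R)"
      using that by (rule principal_right_ideal_ring_if_pa_set) simp
    show ?thesis using 1 2 3 by blast
  qed
  have "principal_right_ideal_ring R \<longleftrightarrow> (\<forall>I. cocritical I R \<longrightarrow> principal_right_ideal I R)"
    using equiv[OF cocritical_pa_set cocritical_closed_under_similarity] by simp
  then show ?thesis using equiv by blast
qed

end
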